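(* Let $K$ be a field, $S=K[x_1,\dots,x_n]$, and let $Q$ and $Q'$ be two monomial primary ideals of $S$ with $\sqrt{Q}=(x_1,\dots,x_t)$ and $\sqrt{Q'}=(x_{r+1},\dots,x_p)$, where $1<r\leq t<p\leq n$ and $n\geq 4$. Then $$\operatorname{sdepth}(Q\cap Q')\leq \min\left\{\frac{2n+t-p-r+2}{2},\ n-\left\lfloor\frac{t}{2}\right\rfloor,\ n-\left\lfloor\frac{p-t}{2}\right\rfloor\right\}.$$ The inequality becomes equality if $t=r$, $n$ is odd and $Q$, $Q'$ are irreducible.
   Context: Let $S=K[x_1,\dots,x_n]$ be a polynomial ring over a field $K$ with its standard $\mathbb{Z}^n$-grading, and let $M$ be a finitely generated $\mathbb{Z}^n$-graded $S$-module. For a homogeneous element $w\in M$ and a subset $Z\subset\{x_1,\dots,x_n\}$, $wK[Z]$ denotes the $K$-subspace of $M$ generated by all homogeneous elements $wv$ with $v$ a monomial in $K[Z]$. It is called a Stanley space of dimension $|Z|$ if it is a free $K[Z]$-module. A Stanley decomposition of $M$ is a presentation of the $K$-vector space $M$ as a finite direct sum of Stanley spaces $\mathcal{D}: M=\bigoplus_{i=1}^s u_iK[Z_i]$, and $\operatorname{sdepth}\mathcal{D}=\min\{|Z_i| : i=1,\dots,s\}$. The Stanley depth of $M$ is $\operatorname{sdepth}(M)=\max\{\operatorname{sdepth}\mathcal{D} : \mathcal{D}\text{ is a Stanley decomposition of } M\}$. A monomial ideal is irreducible if it is not the intersection of two strictly larger monomial ideals, equivalently if it is generated by powers of some of the 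variables.
   Formalization: The equality clause is proved as sdepth(Q∩Q') = the integer part of the minimum, since the minimum need not be an integer (n=p=5, t=r=2, Q=(x1,x2), Q'=(x3,x4,x5) gives 7/2); when it is an integer the equality is literal. *)

theory Defs
  imports Complex_Main "HOL-Library.Poly_Mapping" "HOL-Algebra.Ideal"
begin

text \<open>
  A power product is a finitely supported exponent function on the variable indices, and
  a polynomial a finitely supported coefficient function on power products. The type
  has a variable for every natural number; only \<open>1, \<dots>, n\<close> are used below.
\<close>

type_synonym 'k mpoly = "(nat \<Rightarrow>\<^sub>0 nat) \<Rightarrow>\<^sub>0 'k"

definition pp_in :: "nat set \<Rightarrow> (nat \<Rightarrow>\<^sub>0 nat) set" where
  "pp_in Z = {a. Poly_Mapping.keys a \<subseteq> Z}"

text \<open>The set underlying \<open>K[Z]\<close>.\<close>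

definition polys_in :: "nat set \<Rightarrow> 'k::field mpoly set" where
  "polys_in Z = {f. Poly_Mapping.keys f \<subseteq> pp_in Z}"

definition mon :: "(nat \<Rightarrow>\<^sub>0 nat) \<Rightarrow> 'k::field mpoly" where
  "mon a = Poly_Mapping.single a 1"

definition var :: "nat \<Rightarrow> 'k::field mpoly" where
  "var i = mon (Poly_Mapping.single i 1)"

definition poly_ring :: "nat \<Rightarrow> 'k::field mpoly ring" where
  "poly_ring n = \<lparr>carrier = polys_in {1..n}, monoid.mult = (*), one = 1, zero = 0, add = (+)\<rparr>"


subsection \<open>Ideals\<close>

definition radical :: "nat \<Rightarrow> 'k::field mpoly set \<Rightarrow> 'k mpoly set" where
  "radical n I = {f \<in> carrier (poly_ring n). \<exists>k::nat. f ^ k \<in> I}"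

definition primary_ideal :: "nat \<Rightarrow> 'k::field mpoly set \<Rightarrow> bool" where
  "primary_ideal n I \<longleftrightarrow>
     ideal I (poly_ring n) \<and> I \<noteq> carrier (poly_ring n) \<and>
     (\<forall>f\<in>carrier (poly_ring n). \<forall>g\<in>carrier (poly_ring n).
        f * g \<in> I \<longrightarrow> f \<in> I \<or> g \<in> radical n I)"

definition monomial_ideal :: "nat \<Rightarrow> 'k::field mpoly set \<Rightarrow> bool" where
  "monomial_ideal n I \<longleftrightarrow> (\<exists>A \<subseteq> mon ` pp_in {1..n}. I = Idl\<^bsub>poly_ring n\<^esub> A)"

definition irreducible_monomial_ideal :: "nat \<Rightarrow> 'k::field mpoly set \<Rightarrow> bool" where
  "irreducible_monomial_ideal n I \<longleftrightarrow>
     monomial_ideal n I \<and>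
     \<not> (\<exists>J J'. monomial_ideal n J \<and> monomial_ideal n J' \<and> I \<subset> J \<and> I \<subset> J' \<and> I = J \<inter> J')"


subsection \<open>Stanley decompositions and Stanley depth\<close>

text \<open>Scalar multiplication of the \<open>K\<close>-vector space of polynomials.\<close>

definition kscale :: "'k::field \<Rightarrow> 'k mpoly \<Rightarrow> 'k mpoly" where
  "kscale c f = Poly_Mapping.single 0 c * f"

global_interpretation kvs: vector_space "kscale :: 'k::field \<Rightarrow> 'k mpoly \<Rightarrow> 'k mpoly"
proof
  show "kscale a (x + y) = kscale a x + kscale a y" for a :: 'k and x y
    by (simp add: kscale_def algebra_simps)
  show "kscale (a + b) x = kscale a x + kscale b x" for a b :: 'k and x
    by (simp add: kscale_def single_add algebra_simps)
  show "kscale a (kscale b x) = kscale (a * b) x" for a b :: 'k and x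
    by (simp add: kscale_def mult_single flip: mult.assoc)
  show "kscale 1 x = x" for x :: "'k mpoly"
    by (simp add: kscale_def)
qed

text \<open>
  In the standard \<open>\<int>\<^sup>n\<close>-grading the component of degree \<open>a\<close> is \<open>K x\<^sup>a\<close> if \<open>a\<close> has no
  negative entry, and zero otherwise.
\<close>

definition homogeneous :: "'k::field mpoly \<Rightarrow> bool" where
  "homogeneous f \<longleftrightarrow> (\<exists>a c. f = Poly_Mapping.single a c)"

text \<open>The space \<open>wK[Z]\<close>.\<close>

definition gen_space :: "'k::field mpoly \<Rightarrow> nat set \<Rightarrow> 'k mpoly set" where
  "gen_space w Z = kvs.span ((\<lambda>a. w * mon a) ` pp_in Z)"

text \<open>\<open>V\<close>, closed under the action of the subring \<open>R\<close>, is free as an \<open>R\<close>-module: it has a basis \<open>B\<close>.\<close>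

definition free_over :: "'k::field mpoly set \<Rightarrow> 'k mpoly set \<Rightarrow> bool" where
  "free_over R V \<longleftrightarrow>
     (\<exists>B \<subseteq> V. \<forall>v\<in>V. \<exists>!c. range c \<subseteq> R \<and> finite {b. c b \<noteq> 0} \<and> {b. c b \<noteq> 0} \<subseteq> B \<and>
        v = (\<Sum>b | c b \<noteq> 0. c b * b))"

text \<open>
  The \<open>\<int>\<^sup>n\<close>-graded modules considered here are the graded submodules \<open>M\<close> of \<open>S\<close>, that is, the
  monomial ideals. The pair \<open>(w, Z)\<close> presents the Stanley space \<open>wK[Z]\<close> in \<open>M\<close>. The zero
  space, for which \<open>|Z|\<close> would be arbitrary, is excluded.
\<close>

definition stanley_space :: "nat \<Rightarrow> 'k::field mpoly set \<Rightarrow> 'k mpoly \<times> nat set \<Rightarrow> bool" where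
  "stanley_space n M = (\<lambda>(w, Z).
     w \<in> M \<and> w \<noteq> 0 \<and> homogeneous w \<and> Z \<subseteq> {1..n} \<and> free_over (polys_in Z) (gen_space w Z))"

text \<open>
  The list \<open>[(u\<^sub>0, Z\<^sub>0), \<dots>]\<close> presents \<open>M\<close> as an internal direct sum: every element of \<open>M\<close> is
  a sum of elements of the spaces \<open>u\<^sub>iK[Z\<^sub>i]\<close> in exactly one way, and all such sums lie in \<open>M\<close>.
\<close>

definition stanley_decomposition ::
    "nat \<Rightarrow> 'k::field mpoly set \<Rightarrow> ('k mpoly \<times> nat set) list \<Rightarrow> bool" where
  "stanley_decomposition n M D \<longleftrightarrow>
     (\<forall>d\<in>set D. stanley_space n M d) \<and>
     bij_betw (\<lambda>v. \<Sum>i<length D. v i)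
       (\<Pi>\<^sub>E i\<in>{..<length D}. gen_space (fst (D ! i)) (snd (D ! i))) M"

definition sdepth_decomp :: "('k::field mpoly \<times> nat set) list \<Rightarrow> nat" where
  "sdepth_decomp D = Min ((\<lambda>(w, Z). card Z) ` set D)"

text \<open>Meaningful for \<open>M \<noteq> 0\<close>, where no decomposition is empty and all depths are at most \<open>n\<close>.\<close>

definition sdepth :: "nat \<Rightarrow> 'k::field mpoly set \<Rightarrow> nat" where
  "sdepth n M = Max {sdepth_decomp D | D. stanley_decomposition n M D}"

end

theory Submission
  imports Defs "HOL-Library.Disjoint_Sets"
begin

text \<open>
  A monomial ideal is the span of an upward closed set of exponents, and a Stanley decomposition
  partitions this set into cells \<open>a + \<nat>\<^sup>Z\<close>.

  Upper bounds: choose an exponent \<open>v\<close> outside the ideal, maximal in suitable directions \<open>W\<close>, such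
  that \<open>v + e\<^sub>i\<close> (for \<open>i \<in> W\<close>), respectively \<open>v + e\<^sub>i + e\<^sub>j\<close> (for \<open>i \<le> r\<close>, \<open>t < j\<close>), are minimal in the
  ideal above \<open>v\<close>. They lie in different cells, and these cells compete for the exponents one
  step higher, each of which is reachable from two of them.

  Lower bound: for irreducible ideals, comparing each exponent with the generating power of its
  variable reduces the claim to a partition of the sets that meet both \<open>{1..r}\<close> and
  \<open>{r+1..p}\<close> into intervals with tops of size at least \<open>p div 2 + 1\<close>. If \<open>r\<close> or \<open>p - r\<close> is odd, it is
  the product of two interval partitions of nonempty subsets. If both are even, the product
  misses the bound by one, and the gap is closed by copying the partition of the sets that meet
  both \<open>{1,2}\<close> and \<open>{3,4}\<close>.
\<close>

section \<open>Interval partitions of set families\<close>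

text \<open>The order is inclusion, so \<open>{A..B}\<close> is a Boolean interval with top
  \<open>B\<close>. The family is a finite disjoint union of intervals whose tops have at least
  \<open>k\<close> elements, built one interval at a time so that arguments run by induction over
  the intervals.\<close>

inductive tiled :: "nat \<Rightarrow> 'a set set \<Rightarrow> bool" for k where
  tiled_empty: "tiled k {}"
| tiled_interval: "tiled k U \<Longrightarrow> A \<subseteq> B \<Longrightarrow> finite B \<Longrightarrow> k \<le> card B \<Longrightarrow> U \<inter> {A..B} = {} \<Longrightarrow>
    tiled k (U \<union> {A..B})"

lemma tiled_single: "A \<subseteq> B \<Longrightarrow> finite B \<Longrightarrow> k \<le> card B \<Longrightarrow> tiled k {A..B}"
  using tiled_interval[OF tiled_empty] by fastforce

text \<open>This and the next fact supply the two one-element factors used below: \<open>x\<close>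
  forced into the set, or \<open>x\<close> left free. Both have a top of size 1.\<close>

lemma tiled_point: "tiled 1 {{x}}"
  using tiled_single[of "{x}" "{x}"] by simp

lemma tiled_free: "tiled 1 {{}..{x}}"
  by (rule tiled_single) auto

lemma tiled_Un:
  assumes "tiled k V" "tiled k U" "U \<inter> V = {}"
  shows "tiled k (U \<union> V)"
  using assms
proof (induction rule: tiled.induct)
  case (tiled_interval V A B)
  then have "tiled k (U \<union> V)" by blast
  then have "tiled k (U \<union> V \<union> {A..B})"
    using tiled_interval by (intro tiled.tiled_interval) auto
  then show ?case by (simp add: Un_assoc)
qed simp

lemma tiled_mono:
  assumes "tiled l U" "k \<le> l"
  shows "tiled k U"
  using assms by (induction rule: tiled.induct) (auto intro: tiled.intros)

section \<open>Products of set families over disjoint ground sets\<close>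

definition joins :: "'a set set \<Rightarrow> 'a set set \<Rightarrow> 'a set set" (infixl \<open>\<bowtie>\<close> 70) where
  "U \<bowtie> V = {X \<union> Y | X Y. X \<in> U \<and> Y \<in> V}"

lemma joins_interval: "A \<subseteq> B \<Longrightarrow> C \<subseteq> D \<Longrightarrow> {A..B} \<bowtie> {C..D} = {A \<union> C..B \<union> D}"
proof (intro equalityI subsetI)
  fix X assume AB: "A \<subseteq> B" and CD: "C \<subseteq> D" and X: "X \<in> {A \<union> C..B \<union> D}"
  have "X = (X \<inter> B) \<union> (X \<inter> D)" using X by auto
  moreover have "X \<inter> B \<in> {A..B}" "X \<inter> D \<in> {C..D}" using X AB CD by auto
  ultimately show "X \<in> {A..B} \<bowtie> {C..D}" unfolding joins_def by blast
qed (auto simp: joins_def)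

lemma joins_Un_left: "(U \<union> U') \<bowtie> V = (U \<bowtie> V) \<union> (U' \<bowtie> V)"
  and joins_Un_right: "U \<bowtie> (V \<union> V') = (U \<bowtie> V) \<union> (U \<bowtie> V')"
  by (auto simp: joins_def)

text \<open>Over disjoint ground sets \<open>joins\<close> acts as a Cartesian product: the left
  factor of a union is recovered by intersecting with \<open>R\<close>.\<close>

lemma joins_disjoint_left:
  assumes "U \<subseteq> Pow R" "U' \<subseteq> Pow R" "V \<subseteq> Pow S" "V' \<subseteq> Pow S" "R \<inter> S = {}" "U \<inter> U' = {}"
  shows "(U \<bowtie> V) \<inter> (U' \<bowtie> V') = {}"
proof -
  have False if "X \<in> U" "Y \<in> V" "X' \<in> U'" "Y' \<in> V'" "X \<union> Y = X' \<union> Y'" for X Y X' Y'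
  proof -
    have "X \<subseteq> R" "Y \<subseteq> S" "X' \<subseteq> R" "Y' \<subseteq> S" using assms(1-4) that(1-4) by auto
    then have "(X \<union> Y) \<inter> R = X" "(X' \<union> Y') \<inter> R = X'" using assms(5) by auto
    then have "X = X'" using that(5) by simp
    then show False using that(1,3) assms(6) by blast
  qed
  then show ?thesis unfolding joins_def disjoint_iff mem_Collect_eq by metis
qed

lemma joins_commute: "U \<bowtie> V = V \<bowtie> U"
  by (auto simp: joins_def Un_commute)

lemma joins_disjoint_right:
  assumes "U \<subseteq> Pow R" "U' \<subseteq> Pow R" "V \<subseteq> Pow S" "V' \<subseteq> Pow S" "R \<inter> S = {}" "V \<inter> V' = {}"
  shows "(U \<bowtie> V) \<inter> (U' \<bowtie> V') = {}"
  using joins_disjoint_left[of V S V' U R U'] assms by (simp add: joins_commute Int_commute)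

text \<open>The product of two intervals is an interval, and as the ground sets are disjoint the
  sizes of the tops add. A nested induction runs through all pairs of intervals.\<close>

lemma tiled_joins:
  assumes "tiled k U" "tiled l V" "U \<subseteq> Pow R" "V \<subseteq> Pow S" "R \<inter> S = {}"
  shows "tiled (k + l) (U \<bowtie> V)"
  using assms(1,3)
proof (induction rule: tiled.induct)
  case tiled_empty
  then show ?case by (simp add: joins_def tiled.tiled_empty)
next
  case (tiled_interval U A B)
  have UR: "U \<subseteq> Pow R" and BR: "{A..B} \<subseteq> Pow R" using tiled_interval by auto
  have B: "B \<subseteq> R" using subsetD[OF BR, of B] \<open>A \<subseteq> B\<close> by simp
  have "tiled (k + l) ({A..B} \<bowtie> V)"
    using assms(2,4)
  proof (induction rule: tiled.induct)
    case tiled_empty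
    then show ?case by (simp add: joins_def tiled.tiled_empty)
  next
    case (tiled_interval V C D)
    have V: "V \<subseteq> Pow S" and DS: "{C..D} \<subseteq> Pow S" using tiled_interval by auto
    have D: "D \<subseteq> S" using subsetD[OF DS, of D] \<open>C \<subseteq> D\<close> by simp
    have "B \<inter> D = {}" using B D assms(5) by auto
    then have "card (B \<union> D) = card B + card D"
      using \<open>finite B\<close> \<open>finite D\<close> by (intro card_Un_disjoint) auto
    then have "tiled (k + l) ({A..B} \<bowtie> {C..D})"
      using \<open>A \<subseteq> B\<close> \<open>C \<subseteq> D\<close> \<open>finite B\<close> \<open>finite D\<close> \<open>k \<le> card B\<close> \<open>l \<le> card D\<close>
      by (auto simp: joins_interval intro!: tiled_single)
    moreover have "({A..B} \<bowtie> V) \<inter> ({A..B} \<bowtie> {C..D}) = {}"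
      using tiled_interval BR V DS assms(5) by (intro joins_disjoint_right[of _ R _ _ S]) auto
    ultimately show ?case
      using tiled_interval V by (auto simp: joins_Un_right intro: tiled_Un)
  qed
  moreover have "(U \<bowtie> V) \<inter> ({A..B} \<bowtie> V) = {}"
    using tiled_interval UR BR assms(4,5) by (intro joins_disjoint_left[of _ R _ _ S]) auto
  ultimately show ?case
    using tiled_interval UR by (auto simp: joins_Un_left intro: tiled_Un)
qed

text \<open>
  The two-state automaton that reads a set \<open>X\<close> along a list, last entry first: from state
  \<open>False\<close> it always moves to \<open>True\<close>, from state \<open>True\<close> it moves to \<open>False\<close> exactly on
  elements outside \<open>X\<close>. Sets with the same run form an interval, whose free elements are
  those read in state \<open>False\<close>. They pair up with the elements forced out, up to one
  determined by the initial and final states. So the tops have about half the size of the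
  list.
\<close>

fun final_state :: "'a list \<Rightarrow> bool \<Rightarrow> 'a set \<Rightarrow> bool" where
  "final_state [] i X = i"
| "final_state (x # xs) i X = (x \<in> X \<or> \<not> final_state xs i X)"

definition runs :: "'a list \<Rightarrow> bool \<Rightarrow> bool \<Rightarrow> 'a set set" where
  "runs xs i j = {X. X \<subseteq> set xs \<and> final_state xs i X = j}"

lemma runs_subset: "runs xs i j \<subseteq> Pow (set xs)"
  by (auto simp: runs_def)

lemma final_state_cong: "X \<inter> set xs = Y \<inter> set xs \<Longrightarrow> final_state xs i X = final_state xs i Y"
proof (induction xs)
  case (Cons x xs)
  have "X \<inter> set xs = Y \<inter> set xs" "x \<in> X \<longleftrightarrow> x \<in> Y" using Cons.prems by auto
  then show ?case using Cons.IH by simp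
qed simp

lemma final_state_insert: "x \<notin> set xs \<Longrightarrow> final_state xs i (insert x X) = final_state xs i X"
  by (rule final_state_cong) auto

lemma final_state_empty: "final_state xs i {} = (i = even (length xs))"
  by (induction xs) auto

text \<open>Reading an element of \<open>X\<close> leads to \<open>True\<close> from either state,
  so from there on the initial state is forgotten.\<close>

lemma final_state_nonempty:
  "X \<inter> set xs \<noteq> {} \<Longrightarrow> final_state xs i X = final_state xs i' X"
  by (induction xs) auto

lemma runs_Cons_False: "x \<notin> set xs \<Longrightarrow> runs (x # xs) i False = runs xs i True"
  by (auto simp: runs_def)

lemma joins_pt: "U \<bowtie> {{x}} = insert x ` U"
  by (auto simp: joins_def)

lemma joins_free: "U \<bowtie> {{}..{x}} = U \<union> insert x ` U"
  by (auto simp: joins_def subset_singleton_iff)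

text \<open>State \<open>True\<close> is reached from \<open>False\<close> with \<open>x\<close>
  free, or from \<open>True\<close> with \<open>x\<close> forced in. State \<open>False\<close> is
  only reached from \<open>True\<close> with \<open>x\<close> forced out.\<close>

lemma runs_Cons_True:
  assumes "x \<notin> set xs"
  shows "runs (x # xs) i True = (runs xs i False \<bowtie> {{}..{x}}) \<union> (runs xs i True \<bowtie> {{x}})"
proof (intro equalityI subsetI)
  fix X assume X: "X \<in> runs (x # xs) i True"
  show "X \<in> (runs xs i False \<bowtie> {{}..{x}}) \<union> (runs xs i True \<bowtie> {{x}})"
  proof (cases "x \<in> X")
    case True
    then have "X = insert x (X - {x})" "X - {x} \<subseteq> set xs" using X by (auto simp: runs_def)
    then show ?thesis unfolding joins_pt joins_free runs_def by blast
  next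
    case False
    then show ?thesis using X by (auto simp: joins_pt joins_free runs_def)
  qed
qed (use assms in \<open>auto simp: joins_pt joins_free runs_def final_state_insert\<close>)

text \<open>Along a run the free elements outnumber those forced out by
  \<open>of_bool j - of_bool i\<close>, and a top omits only the latter. So its size is at least
  half of \<open>length xs + of_bool j - of_bool i\<close>, and the hypothesis asks for this half
  rounded up.\<close>

lemma tiled_runs:
  assumes "distinct xs" "2 * k \<le> length xs + of_bool j + of_bool (\<not> i)"
  shows "tiled k (runs xs i j)"
  using assms
proof (induction xs arbitrary: j k)
  case Nil
  then have "i = j \<Longrightarrow> k = 0" by (cases i; cases j) auto
  moreover have "i = j \<Longrightarrow> runs [] i j = {{}..{}}" "i \<noteq> j \<Longrightarrow> runs [] i j = {}"
    by (auto simp: runs_def)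
  moreover have "tiled 0 {{}..{}::'a set}" by (rule tiled_single) auto
  ultimately show ?case using tiled_empty[of k] by metis
next
  case (Cons x xs)
  then have x: "x \<notin> set xs" by simp
  show ?case
  proof (cases j)
    case True
    \<comment> \<open>The element \<open>x\<close> lies in every top, so both preceding classes only
      need tops of size \<open>k - 1\<close>; the bound is the one for the weaker class, which ends
      in \<open>False\<close>.\<close>
    have "distinct xs" "2 * (k - 1) \<le> length xs + of_bool (\<not> i)"
      using Cons.prems True by simp_all
    then have "tiled (k - 1) (runs xs i False)" "tiled (k - 1) (runs xs i True)"
      using Cons.IH[of "k - 1"] by simp_all
    then have "tiled (k - 1 + 1) (runs xs i False \<bowtie> {{}..{x}})"
      "tiled (k - 1 + 1) (runs xs i True \<bowtie> {{x}})"
      using x runs_subset[of xs]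
      by (intro tiled_joins[where R = "set xs" and S = "{x}"] tiled_point tiled_free; auto)+
    moreover have "(runs xs i False \<bowtie> {{}..{x}}) \<inter> (runs xs i True \<bowtie> {{x}}) = {}"
      using x runs_subset[of xs]
      by (intro joins_disjoint_left[where R = "set xs" and S = "{x}"]) (auto simp: runs_def)
    ultimately have "tiled (k - 1 + 1) (runs (x # xs) i True)"
      unfolding runs_Cons_True[OF x] by (intro tiled_Un)
    then show ?thesis using True by (auto intro: tiled_mono)
  next
    case False
    \<comment> \<open>Here \<open>x\<close> adds nothing to the tops, but the shorter run ends in
      \<open>True\<close>, and this \<open>of_bool\<close> replaces the lost unit of length.\<close>
    then have "tiled k (runs xs i True)" using Cons.prems Cons.IH[of k True] by simp
    then show ?thesis using x False by (simp add: runs_Cons_False)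
  qed
qed

text \<open>Nonempty sets reach the same final state from both initial states. Hence the class
  ending in \<open>True\<close> may be started from one state and the class ending in
  \<open>False\<close> from the other, chosen so that the empty set falls into neither.\<close>

lemma tiled_nonempty_subsets:
  assumes "finite R"
  shows "tiled ((card R + 1) div 2) (Pow R - {{}})"
proof -
  obtain xs where xs: "set xs = R" "distinct xs" using assms finite_distinct_list by blast
  \<comment> \<open>From this state the run of the empty set ends in \<open>False\<close>, from the
    opposite one in \<open>True\<close>.\<close>
  define i where "i = odd (length xs)"
  have len: "length xs = card R" using xs distinct_card[of xs] by simp
  have same: "final_state xs i X = final_state xs (\<not> i) X" if "X \<subseteq> set xs" "X \<noteq> {}" for X
    using that by (intro final_state_nonempty) auto
  have empty: "\<not> final_state xs i {}" "final_state xs (\<not> i) {}"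
    by (simp_all add: final_state_empty i_def)
  have iff: "X \<in> runs xs i True \<longleftrightarrow> X \<subseteq> R \<and> X \<noteq> {} \<and> final_state xs i X"
    "X \<in> runs xs (\<not> i) False \<longleftrightarrow> X \<subseteq> R \<and> X \<noteq> {} \<and> \<not> final_state xs i X" for X
    using same[of X] empty xs(1) unfolding runs_def mem_Collect_eq by metis+
  have "Pow R - {{}} = runs xs i True \<union> runs xs (\<not> i) False"
    using iff by blast
  moreover have "tiled ((card R + 1) div 2) (runs xs i True \<union> runs xs (\<not> i) False)"
  proof (intro tiled_Un tiled_runs xs(2))
    show "runs xs i True \<inter> runs xs (\<not> i) False = {}"
      using iff by blast
    show "2 * ((card R + 1) div 2) \<le> length xs + of_bool True + of_bool (\<not> i)"
      "2 * ((card R + 1) div 2) \<le> length xs + of_bool False + of_bool (\<not> \<not> i)"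
      by (auto simp: i_def len elim!: oddE)
  qed
  ultimately show ?thesis by simp
qed

text \<open>
  For a set of even size \<open>2 * m\<close> the tops of size \<open>m\<close> cannot be avoided, but the parts \<open>U\<close>, \<open>V\<close>, \<open>W\<close>
  behave like \<open>{1}\<close>, \<open>{2}\<close>, \<open>{1,2}\<close> for a pair: adding \<open>W\<close> to one of the others improves its tops.
\<close>

lemma even_split:
  assumes "finite R" "card R = 2 * m" "0 < m"
  obtains U V W where "Pow R - {{}} = U \<union> V \<union> W" "U \<inter> V = {}" "U \<inter> W = {}" "V \<inter> W = {}"
    "tiled m U" "tiled m V" "tiled (Suc m) W" "tiled (Suc m) (U \<union> W)" "tiled (Suc m) (V \<union> W)"
proof -
  \<comment> \<open>One element is set apart; the automaton reads the remaining odd number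
    \<open>2 * m - 1\<close> of elements.\<close>
  obtain d where d: "d \<in> R" using assms by fastforce
  obtain ys where ys: "set ys = R - {d}" "distinct ys"
    using assms(1) finite_distinct_list by (metis finite_Diff)
  have len: "length ys = 2 * m - 1"
    using ys d assms by (metis card_Diff_singleton distinct_card)
  have odd: "odd (length ys)" using len assms(3) by simp
  let ?r = "runs ys"
  have sub: "?r i j \<subseteq> Pow (R - {d})" for i j using runs_subset ys(1) by metis
  \<comment> \<open>Changing the initial state moves only the empty set, because its run alternates
    along a list of odd length.\<close>
  have T: "?r False True = insert {} (?r True True)" and F: "?r True False = insert {} (?r False False)"
    using final_state_nonempty[of _ ys True False] odd
    by (auto simp: runs_def final_state_empty) (metis Int_absorb2 final_state_empty)+
  have T0: "{} \<notin> ?r True True" and F0: "{} \<notin> ?r False False"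
    using odd by (auto simp: runs_def final_state_empty)
  have TF: "?r True True \<inter> ?r True False = {}" "?r False True \<inter> ?r False False = {}"
    by (auto simp: runs_def)
  have all: "Pow (R - {d}) = ?r True True \<union> ?r True False" using ys(1) by (auto simp: runs_def)
  let ?p = "\<lambda>U. U \<bowtie> {{d}}"
  have tile: "tiled k (?r i j)" if "2 * k \<le> 2 * m - 1 + of_bool j + of_bool (\<not> i)" for k i j
    using tiled_runs[OF ys(2)] that len by metis
  have tile_p: "tiled (Suc k) (?p (?r i j))" if "tiled k (?r i j)" for k i j
    using tiled_joins[OF that tiled_point sub, of d "{d}"] by simp
  have tile_f: "tiled (Suc k) (?r i j \<bowtie> {{}..{d}})" if "tiled k (?r i j)" for k i j
    using tiled_joins[OF that tiled_free sub, of d "{d}"]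
    by (simp add: subset_iff Ball_def)
  have disj_p: "?p (?r i j) \<inter> ?p (?r i' j') = {}" if "?r i j \<inter> ?r i' j' = {}" for i j i' j'
    using that sub by (intro joins_disjoint_left[of _ "R - {d}" _ _ "{d}"]) auto
  have disj_d: "?r i j \<inter> ?p (?r i' j') = {}" for i j i' j'
    using sub by (auto simp: joins_def)
  \<comment> \<open>For \<open>m = 1\<close> and a second element \<open>y\<close> these are the
    families containing only \<open>{d}\<close>, only \<open>{y}\<close> and only
    \<open>{d, y}\<close>, respectively.\<close>
  define U where "U = ?r False False \<union> ?p (?r True False)"
  define V where "V = ?r True True"
  define W where "W = ?p (?r True True)"
  \<comment> \<open>The set \<open>{d}\<close> changes sides: joined to \<open>W\<close> it turns
    the initial state \<open>True\<close> into \<open>False\<close>, which allows larger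
    tops.\<close>
  have UW: "U \<union> W = (?r False False \<bowtie> {{}..{d}}) \<union> ?p (?r False True)"
    unfolding U_def W_def joins_free joins_pt F T by auto
  show thesis
  proof (rule that[of U V W])
    have "Pow R = Pow (R - {d}) \<union> insert d ` Pow (R - {d})"
      using d by (metis Pow_insert insert_Diff)
    then have "Pow R = V \<union> ?r True False \<union> W \<union> ?p (?r True False)"
      unfolding all V_def W_def joins_pt by auto
    moreover have "{} \<notin> U \<union> V \<union> W" using T0 F0 by (auto simp: U_def V_def W_def joins_pt)
    ultimately show "Pow R - {{}} = U \<union> V \<union> W" unfolding F U_def by auto
    show "U \<inter> V = {}" using disj_d[of True True True False] TF T unfolding U_def V_def by auto
    show "U \<inter> W = {}" using disj_d[of False False True True] disj_p[of True False True True] TF(1)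
      unfolding U_def W_def by auto
    show "V \<inter> W = {}" using disj_d unfolding V_def W_def by auto
    have "tiled m (?p (?r True False))"
      using tile_p[OF tile[of "m - 1" False True]] assms(3) by simp
    then show "tiled m U" unfolding U_def using assms(3) by (intro tiled_Un tile disj_d) auto
    show "tiled m V" unfolding V_def using assms(3) by (auto intro!: tile)
    show "tiled (Suc m) W" unfolding W_def using assms(3) by (intro tile_p tile) auto
    have "(?r False False \<bowtie> {{}..{d}}) \<inter> ?p (?r False True) = {}"
      using sub TF(2) by (intro joins_disjoint_left[of _ "R - {d}" _ _ "{d}"]) auto
    then show "tiled (Suc m) (U \<union> W)" unfolding UW
      using assms(3) by (intro tiled_Un tile_p tile_f tile) auto
    have "V \<union> W = ?r True True \<bowtie> {{}..{d}}" unfolding V_def W_def joins_free joins_pt ..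
    then show "tiled (Suc m) (V \<union> W)" using assms(3) by (auto intro!: tile_f tile)
  qed
qed

text \<open>Multiplying the two splittings gives nine blocks. The four products of \<open>U\<close>,
  \<open>V\<close> with \<open>U'\<close>, \<open>V'\<close> would only have tops of size
  \<open>m + l\<close>, but there are also four blocks with exactly one factor \<open>W\<close> or
  \<open>W'\<close>. Each of the former absorbs one of the latter, which raises its tops by one; the
  block of \<open>W\<close> and \<open>W'\<close> stands alone.\<close>

lemma tiled_mixed_even:
  assumes "finite R" "card R = 2 * m" "0 < m" "finite S" "card S = 2 * l" "0 < l" "R \<inter> S = {}"
  shows "tiled (m + l + 1) ((Pow R - {{}}) \<bowtie> (Pow S - {{}}))"
proof -
  obtain U V W where R: "Pow R - {{}} = U \<union> V \<union> W" "U \<inter> V = {}" "U \<inter> W = {}" "V \<inter> W = {}"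
    "tiled m U" "tiled m V" "tiled (Suc m) W" "tiled (Suc m) (U \<union> W)" "tiled (Suc m) (V \<union> W)"
    using even_split[OF assms(1-3)] by metis
  obtain U' V' W' where S: "Pow S - {{}} = U' \<union> V' \<union> W'" "U' \<inter> V' = {}" "U' \<inter> W' = {}" "V' \<inter> W' = {}"
    "tiled l U'" "tiled l V'" "tiled (Suc l) W'" "tiled (Suc l) (U' \<union> W')" "tiled (Suc l) (V' \<union> W')"
    using even_split[OF assms(4-6)] by metis
  have sub: "U \<subseteq> Pow R" "V \<subseteq> Pow R" "W \<subseteq> Pow R" "U' \<subseteq> Pow S" "V' \<subseteq> Pow S" "W' \<subseteq> Pow S"
    using R(1) S(1) by auto
  have tile: "tiled (m + l + 1) (X \<bowtie> Y)"
    if "tiled a X" "tiled b Y" "m + l + 1 \<le> a + b" "X \<subseteq> Pow R" "Y \<subseteq> Pow S" for a b X Y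
    using tiled_joins[OF that(1,2,4,5) assms(7)] that(3) tiled_mono by blast
  have eq: "(Pow R - {{}}) \<bowtie> (Pow S - {{}}) = ((((U \<union> W) \<bowtie> U') \<union> (V \<bowtie> (U' \<union> W'))) \<union>
      ((V \<union> W) \<bowtie> V') \<union> (U \<bowtie> (V' \<union> W'))) \<union> (W \<bowtie> W')"
    unfolding R(1) S(1) joins_Un_left joins_Un_right by auto
  have dR: "(X \<bowtie> Y) \<inter> (X' \<bowtie> Y') = {}" if "X \<inter> X' = {}"
    "X \<subseteq> Pow R" "X' \<subseteq> Pow R" "Y \<subseteq> Pow S" "Y' \<subseteq> Pow S" for X X' Y Y'
    using joins_disjoint_left that assms(7) by metis
  have dS: "(X \<bowtie> Y) \<inter> (X' \<bowtie> Y') = {}" if "Y \<inter> Y' = {}"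
    "X \<subseteq> Pow R" "X' \<subseteq> Pow R" "Y \<subseteq> Pow S" "Y' \<subseteq> Pow S" for X X' Y Y'
    using joins_disjoint_right that assms(7) by metis
  have d1: "((U \<union> W) \<bowtie> U') \<inter> (V \<bowtie> (U' \<union> W')) = {}"
    using R(2-4) sub by (intro dR) auto
  have d2: "((U \<union> W) \<bowtie> U') \<inter> ((V \<union> W) \<bowtie> V') = {}" "((U \<union> W) \<bowtie> U') \<inter> (U \<bowtie> (V' \<union> W')) = {}"
    "((U \<union> W) \<bowtie> U') \<inter> (W \<bowtie> W') = {}" "(V \<bowtie> (U' \<union> W')) \<inter> ((V \<union> W) \<bowtie> V') = {}"
    using S(2-4) sub by (intro dS; auto)+
  have d3: "(V \<bowtie> (U' \<union> W')) \<inter> (U \<bowtie> (V' \<union> W')) = {}" "(V \<bowtie> (U' \<union> W')) \<inter> (W \<bowtie> W') = {}"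
    "((V \<union> W) \<bowtie> V') \<inter> (U \<bowtie> (V' \<union> W')) = {}" "(U \<bowtie> (V' \<union> W')) \<inter> (W \<bowtie> W') = {}"
    using R(2-4) sub by (intro dR; auto)+
  have d4: "((V \<union> W) \<bowtie> V') \<inter> (W \<bowtie> W') = {}"
    using S(2-4) sub by (intro dS) auto
  show ?thesis unfolding eq
  proof (intro tiled_Un)
    show "tiled (m + l + 1) ((U \<union> W) \<bowtie> U')" using R S sub by (intro tile) auto
    show "tiled (m + l + 1) (V \<bowtie> (U' \<union> W'))" using R S sub by (intro tile) auto
    show "tiled (m + l + 1) ((V \<union> W) \<bowtie> V')" using R S sub by (intro tile) auto
    show "tiled (m + l + 1) (U \<bowtie> (V' \<union> W'))" using R S sub by (intro tile) auto
    show "tiled (m + l + 1) (W \<bowtie> W')" using R S sub by (intro tile[of "Suc m" _ "Suc l"]) auto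
  qed (use d1 d2 d3 d4 in \<open>simp_all add: Int_Un_distrib2\<close>)
qed

lemma tiled_mixed:
  assumes "finite R" "finite S" "R \<noteq> {}" "S \<noteq> {}" "R \<inter> S = {}"
  shows "tiled ((card R + card S) div 2 + 1) ((Pow R - {{}}) \<bowtie> (Pow S - {{}}))"
proof (cases "even (card R) \<and> even (card S)")
  case True
  then obtain m l where ml: "card R = 2 * m" "card S = 2 * l" by (auto elim!: evenE)
  then have "0 < m" "0 < l" using assms by (auto intro!: gr0I)
  then show ?thesis using tiled_mixed_even[of R m S l] assms ml by auto
next
  case False
  \<comment> \<open>At least one of the sizes is odd, so rounding up in the factors already yields
    the additional one.\<close>
  have "tiled ((card R + 1) div 2 + (card S + 1) div 2) ((Pow R - {{}}) \<bowtie> (Pow S - {{}}))"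
    using assms by (intro tiled_joins[of _ _ _ _ R S] tiled_nonempty_subsets) auto
  then show ?thesis by (rule tiled_mono) (use False in presburger)
qed

section \<open>Decompositions of sets of exponents into cells\<close>

abbreviation lookup :: "('a \<Rightarrow>\<^sub>0 'b::zero) \<Rightarrow> 'a \<Rightarrow> 'b" where
  "lookup \<equiv> Poly_Mapping.lookup"

lemma in_pp_in_iff: "a \<in> pp_in Z \<longleftrightarrow> (\<forall>i. i \<notin> Z \<longrightarrow> lookup a i = 0)"
  by (auto simp: pp_in_def in_keys_iff)

lemma pp_in_add: "a \<in> pp_in Z \<Longrightarrow> b \<in> pp_in Z \<Longrightarrow> a + b \<in> pp_in Z"
  by (simp add: in_pp_in_iff lookup_add)

lemma pp_in_mono: "a \<in> pp_in Z \<Longrightarrow> Z \<subseteq> Z' \<Longrightarrow> a \<in> pp_in Z'"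
  by (auto simp: in_pp_in_iff)

lemma single_in_pp_in: "i \<in> Z \<Longrightarrow> Poly_Mapping.single i k \<in> pp_in Z"
  by (auto simp: in_pp_in_iff lookup_single when_def)

text \<open>Cutting off outside \<open>{1..n}\<close> makes every function finitely supported, so
  exponents can be given by arbitrary functions.\<close>

definition pp_of :: "nat \<Rightarrow> (nat \<Rightarrow> nat) \<Rightarrow> (nat \<Rightarrow>\<^sub>0 nat)" where
  "pp_of n f = Abs_poly_mapping (\<lambda>i. if i \<in> {1..n} then f i else 0)"

lemma lookup_pp_of: "lookup (pp_of n f) i = (if i \<in> {1..n} then f i else 0)"
proof -
  have "finite {i. (if i \<in> {1..n} then f i else 0) \<noteq> 0}"
    by (rule finite_subset[of _ "{1..n}"]) auto
  then show ?thesis unfolding pp_of_def by (subst lookup_Abs_poly_mapping) auto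
qed

lemma pp_of_in_pp_in: "pp_of n f \<in> pp_in {1..n}"
  by (simp add: in_pp_in_iff lookup_pp_of)

definition cell :: "(nat \<Rightarrow>\<^sub>0 nat) \<Rightarrow> nat set \<Rightarrow> (nat \<Rightarrow>\<^sub>0 nat) set" where
  "cell a Z = (+) a ` pp_in Z"

lemma in_cell_iff:
  "b \<in> cell a Z \<longleftrightarrow> (\<forall>i. lookup a i \<le> lookup b i \<and> (i \<notin> Z \<longrightarrow> lookup b i = lookup a i))"
proof
  assume r: "\<forall>i. lookup a i \<le> lookup b i \<and> (i \<notin> Z \<longrightarrow> lookup b i = lookup a i)"
  then have "b = a + (b - a)" by (intro poly_mapping_eqI) (simp add: lookup_add lookup_minus)
  moreover have "b - a \<in> pp_in Z" using r by (simp add: in_pp_in_iff lookup_minus)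
  ultimately show "b \<in> cell a Z" unfolding cell_def by blast
qed (auto simp: cell_def in_pp_in_iff lookup_add)

lemma base_in_cell: "a \<in> cell a Z"
  by (simp add: in_cell_iff)

text \<open>The exponent form of a Stanley decomposition all of whose spaces have dimension at least
  \<open>k\<close>. With \<open>k = 0\<close> it only records that some decomposition
  exists.\<close>

inductive celled :: "nat \<Rightarrow> nat \<Rightarrow> (nat \<Rightarrow>\<^sub>0 nat) set \<Rightarrow> bool" for n k where
  celled_empty: "celled n k {}"
| celled_cell: "celled n k E \<Longrightarrow> Z \<subseteq> {1..n} \<Longrightarrow> k \<le> card Z \<Longrightarrow> E \<inter> cell a Z = {} \<Longrightarrow>
    celled n k (E \<union> cell a Z)"

lemma celled_single: "Z \<subseteq> {1..n} \<Longrightarrow> k \<le> card Z \<Longrightarrow> celled n k (cell a Z)"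
  using celled_cell[OF celled_empty] by fastforce

lemma celled_Un:
  assumes "celled n k F" "celled n k E" "E \<inter> F = {}"
  shows "celled n k (E \<union> F)"
  using assms
proof (induction rule: celled.induct)
  case (celled_cell F Z a)
  then have "celled n k (E \<union> F)" by blast
  then have "celled n k (E \<union> F \<union> cell a Z)"
    using celled_cell by (intro celled.celled_cell) auto
  then show ?case by (simp add: Un_assoc)
qed simp

lemma celled_UN:
  assumes "finite I" "\<And>i. i \<in> I \<Longrightarrow> celled n k (E i)" "disjoint_family_on E I"
  shows "celled n k (\<Union>i\<in>I. E i)"
  using assms
proof (induction rule: finite_induct)
  case (insert i I)
  have "E i \<inter> (\<Union>i\<in>I. E i) = {}"
    using insert.prems(2) insert.hyps(2) unfolding disjoint_family_on_def by fastforce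
  moreover have "disjoint_family_on E I"
    using insert.prems(2) by (rule disjoint_family_on_mono[rotated]) auto
  ultimately show ?case using insert by (auto intro: celled_Un)
qed (simp add: celled_empty)

text \<open>
  Elements of an interval below impose a lower bound on the exponents in \<open>A\<close> and leave those
  in \<open>B - A\<close> free; an exponent outside \<open>B\<close> has finitely many values, which are distributed
  over different cells.
\<close>

lemma celled_thresholds:
  assumes "tiled k U" "U \<subseteq> Pow {1..n}" and pos: "\<And>i. 0 < \<alpha> i"
  shows "celled n k {a \<in> pp_in {1..n}. {i \<in> {1..n}. \<alpha> i \<le> lookup a i} \<in> U}"
  using assms(1,2)
proof (induction rule: tiled.induct)
  case tiled_empty
  then show ?case by (simp add: celled_empty)
next
  case (tiled_interval U A B)
  have AB: "A \<subseteq> B" "B \<subseteq> {1..n}"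
    using tiled_interval subsetD[OF tiled_interval.prems, of B] by simp_all
  let ?\<phi> = "\<lambda>a. {i \<in> {1..n}. \<alpha> i \<le> lookup a i}"
  let ?I = "PiE ({1..n} - B) (\<lambda>i. {..<\<alpha> i})"
  let ?b = "\<lambda>g. pp_of n (\<lambda>i. if i \<in> A then \<alpha> i else if i \<in> B then 0 else g i)"
  have "{a \<in> pp_in {1..n}. ?\<phi> a \<in> {A..B}} = (\<Union>g\<in>?I. cell (?b g) B)"
  proof (intro equalityI subsetI)
    fix a assume "a \<in> {a \<in> pp_in {1..n}. ?\<phi> a \<in> {A..B}}"
    then have a: "a \<in> pp_in {1..n}" "A \<subseteq> ?\<phi> a" "?\<phi> a \<subseteq> B" by auto
    let ?g = "restrict (lookup a) ({1..n} - B)"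
    have "?g \<in> ?I" using a(3) by (auto simp: not_le[symmetric])
    moreover have "a \<in> cell (?b ?g) B"
      using a(1,2) AB by (auto simp: in_cell_iff lookup_pp_of in_pp_in_iff)
    ultimately show "a \<in> (\<Union>g\<in>?I. cell (?b g) B)" by blast
  next
    fix a assume "a \<in> (\<Union>g\<in>?I. cell (?b g) B)"
    then obtain g where g: "g \<in> ?I" and a: "a \<in> cell (?b g) B" by blast
    have ai: "lookup (?b g) i \<le> lookup a i" "i \<notin> B \<Longrightarrow> lookup a i = lookup (?b g) i" for i
      using a by (auto simp: in_cell_iff)
    have "lookup a i = 0" if "i \<notin> {1..n}" for i
    proof -
      have "i \<notin> B" using that AB by blast
      then have "lookup a i = lookup (?b g) i" by (rule ai(2))
      then show ?thesis using that by (simp add: lookup_pp_of del: atLeastAtMost_iff)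
    qed
    moreover have "\<alpha> i \<le> lookup a i" if "i \<in> A" for i
    proof -
      have "i \<in> {1..n}" using that AB by blast
      then show ?thesis using ai(1)[of i] that by (simp add: lookup_pp_of)
    qed
    moreover have "lookup a i < \<alpha> i" if "i \<in> {1..n}" "i \<notin> B" for i
    proof -
      have "i \<notin> A" using that AB by blast
      then have "lookup a i = g i" using ai(2)[of i] that by (simp add: lookup_pp_of)
      then show ?thesis using g that by (auto simp: PiE_iff)
    qed
    ultimately show "a \<in> {a \<in> pp_in {1..n}. ?\<phi> a \<in> {A..B}}"
      using AB by (auto simp: in_pp_in_iff not_le[symmetric])
  qed
  moreover have "celled n k (\<Union>g\<in>?I. cell (?b g) B)"
  proof (rule celled_UN)
    show "finite ?I" by (intro finite_PiE) auto
    show "celled n k (cell (?b g) B)" for g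
      using AB tiled_interval by (intro celled_single) auto
    show "disjoint_family_on (\<lambda>g. cell (?b g) B) ?I"
      unfolding disjoint_family_on_def
    proof (intro ballI impI)
      fix g h assume gh: "g \<in> ?I" "h \<in> ?I" "g \<noteq> h"
      then obtain i where i: "i \<in> {1..n} - B" "g i \<noteq> h i" by (metis PiE_ext)
      then have "i \<notin> A" using AB by auto
      then show "cell (?b g) B \<inter> cell (?b h) B = {}"
        using i by (fastforce simp: in_cell_iff lookup_pp_of)
    qed
  qed
  ultimately have "celled n k {a \<in> pp_in {1..n}. ?\<phi> a \<in> {A..B}}" by simp
  moreover have "{a \<in> pp_in {1..n}. ?\<phi> a \<in> U} \<inter> {a \<in> pp_in {1..n}. ?\<phi> a \<in> {A..B}} = {}"
    using tiled_interval(5) by blast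
  ultimately have "celled n k ({a \<in> pp_in {1..n}. ?\<phi> a \<in> U} \<union> {a \<in> pp_in {1..n}. ?\<phi> a \<in> {A..B}})"
    using tiled_interval by (intro celled_Un) auto
  moreover have "{a \<in> pp_in {1..n}. ?\<phi> a \<in> U \<union> {A..B}} =
    {a \<in> pp_in {1..n}. ?\<phi> a \<in> U} \<union> {a \<in> pp_in {1..n}. ?\<phi> a \<in> {A..B}}" by blast
  ultimately show ?case by simp
qed

lemma finite_bounded_pp: "finite {a \<in> pp_in {1..n}. \<forall>i. lookup a i \<le> N}"
proof (rule finite_subset)
  show "{a \<in> pp_in {1..n}. \<forall>i. lookup a i \<le> N} \<subseteq> pp_of n ` PiE {1..n} (\<lambda>i. {..N})"
  proof
    fix a assume a: "a \<in> {a \<in> pp_in {1..n}. \<forall>i. lookup a i \<le> N}"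
    then have "a = pp_of n (restrict (lookup a) {1..n})"
      by (intro poly_mapping_eqI) (auto simp: lookup_pp_of in_pp_in_iff)
    moreover have "restrict (lookup a) {1..n} \<in> PiE {1..n} (\<lambda>i. {..N})" using a by auto
    ultimately show "a \<in> pp_of n ` PiE {1..n} (\<lambda>i. {..N})" by blast
  qed
  show "finite (pp_of n ` PiE {1..n} (\<lambda>i. {..N}))" by (intro finite_imageI finite_PiE) auto
qed

text \<open>Capping all exponents at \<open>N\<close> maps the set into a finite box, and the fibres
  of this map are cells. This gives a first decomposition, without which the maximum defining the
  depth would range over the empty set.\<close>

lemma celled_truncation:
  assumes sub: "E \<subseteq> pp_in {1..n}"
    and trunc: "\<And>a. a \<in> pp_in {1..n} \<Longrightarrow> a \<in> E \<longleftrightarrow> pp_of n (\<lambda>i. min (lookup a i) N) \<in> E"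
  shows "celled n 0 E"
proof -
  let ?t = "\<lambda>a. pp_of n (\<lambda>i. min (lookup a i) N)"
  \<comment> \<open>The fibre over \<open>b\<close> is free exactly in the directions where
    \<open>b\<close> has reached the cap.\<close>
  let ?Z = "\<lambda>b. {i \<in> {1..n}. lookup b i = N}"
  let ?I = "{b \<in> pp_in {1..n}. \<forall>i. lookup b i \<le> N} \<inter> E"
  have cell: "a \<in> pp_in {1..n} \<and> ?t a = b" if "b \<in> ?I" "a \<in> cell b (?Z b)" for a b
  proof
    show "a \<in> pp_in {1..n}" using that by (auto simp: in_cell_iff in_pp_in_iff)
    have "min (lookup a i) N = lookup b i" if "i \<in> {1..n}" for i
    proof -
      have "lookup b i \<le> lookup a i" "lookup b i \<le> N" "lookup b i = N \<or> lookup a i = lookup b i"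
        using \<open>a \<in> cell b (?Z b)\<close> \<open>b \<in> ?I\<close> that by (auto simp: in_cell_iff)
      then show ?thesis by auto
    qed
    then show "?t a = b"
      using that(1) by (intro poly_mapping_eqI) (auto simp: lookup_pp_of in_pp_in_iff)
  qed
  have "E = (\<Union>b\<in>?I. cell b (?Z b))"
  proof (intro equalityI subsetI)
    fix a assume a: "a \<in> E"
    then have "a \<in> pp_in {1..n}" using sub by blast
    then have "?t a \<in> E" using a trunc by blast
    then have "?t a \<in> ?I" by (simp add: pp_of_in_pp_in lookup_pp_of del: One_nat_def)
    moreover have "a \<in> cell (?t a) (?Z (?t a))"
      using \<open>a \<in> pp_in {1..n}\<close> by (auto simp: in_cell_iff lookup_pp_of in_pp_in_iff min_def)
    ultimately show "a \<in> (\<Union>b\<in>?I. cell b (?Z b))" by blast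
  next
    fix a assume "a \<in> (\<Union>b\<in>?I. cell b (?Z b))"
    then obtain b where "b \<in> ?I" "a \<in> cell b (?Z b)" by blast
    then show "a \<in> E" using cell trunc by blast
  qed
  moreover have "celled n 0 (\<Union>b\<in>?I. cell b (?Z b))"
  proof (rule celled_UN)
    show "finite ?I" using finite_bounded_pp by blast
    show "celled n 0 (cell b (?Z b))" for b by (intro celled_single) auto
    show "disjoint_family_on (\<lambda>b. cell b (?Z b)) ?I"
      using cell unfolding disjoint_family_on_def by blast
  qed
  ultimately show ?thesis by simp
qed

section \<open>Upward closed exponent sets and the counting of their cells\<close>

definition up_closed :: "nat \<Rightarrow> (nat \<Rightarrow>\<^sub>0 nat) set \<Rightarrow> bool" where
  "up_closed n E \<longleftrightarrow> E \<subseteq> pp_in {1..n} \<and> (\<forall>a\<in>E. \<forall>b\<in>pp_in {1..n}. a + b \<in> E)"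

lemma up_closedD:
  assumes "up_closed n E" "a \<in> E" "b \<in> pp_in {1..n}" "\<And>i. lookup a i \<le> lookup b i"
  shows "b \<in> E"
proof -
  have "b = a + (b - a)" using assms(4) by (intro poly_mapping_eqI) (simp add: lookup_add lookup_minus)
  moreover have "b - a \<in> pp_in {1..n}" using assms(3) by (auto simp: in_pp_in_iff lookup_minus)
  ultimately show ?thesis using assms(1,2) unfolding up_closed_def by metis
qed

lemma up_closed_Int: "up_closed n E \<Longrightarrow> up_closed n F \<Longrightarrow> up_closed n (E \<inter> F)"
  unfolding up_closed_def by blast

text \<open>Among the exponents supported on \<open>T\<close> and outside \<open>E\<close>, one of
  maximal total degree is taken; the pure powers in \<open>E\<close> bound this degree.\<close>

lemma maximal_outside:
  assumes E: "up_closed n E" "0 \<notin> E" and T: "T \<subseteq> {1..n}"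
    and N: "\<And>i. i \<in> T \<Longrightarrow> Poly_Mapping.single i N \<in> E"
  obtains v where "v \<in> pp_in T" "v \<notin> E" "\<And>i. i \<in> T \<Longrightarrow> v + Poly_Mapping.single i 1 \<in> E"
proof -
  let ?P = "\<lambda>v. v \<in> pp_in T \<and> v \<notin> E" and ?f = "\<lambda>v. \<Sum>i\<in>T. lookup v i"
  have finT: "finite T" using T finite_subset by blast
  have bound: "?f v \<le> (\<Sum>i\<in>T. N)" if "?P v" for v
  proof (rule sum_mono, rule ccontr)
    fix i assume i: "i \<in> T" "\<not> lookup v i \<le> N"
    then have "v \<in> E" using that T N[OF i(1)]
      by (intro up_closedD[OF E(1) N[OF i(1)]]) (auto simp: lookup_single when_def intro: pp_in_mono)
    then show False using that by simp
  qed
  have "?P 0" using E by (simp add: in_pp_in_iff)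
  then have "\<exists>v. ?P v \<and> (\<forall>w. ?P w \<longrightarrow> ?f w \<le> ?f v)"
    using bound by (intro ex_has_greatest_nat[of ?P 0 ?f "Suc (\<Sum>i\<in>T. N)"])
      (auto simp: less_Suc_eq_le)
  then obtain v where v: "?P v" "\<And>w. ?P w \<Longrightarrow> ?f w \<le> ?f v" by metis
  have "v + Poly_Mapping.single i 1 \<in> E" if "i \<in> T" for i
  proof (rule ccontr)
    assume "v + Poly_Mapping.single i 1 \<notin> E"
    then have "?f (v + Poly_Mapping.single i 1) \<le> ?f v"
      using v(1) that by (intro v(2)) (auto intro: pp_in_add single_in_pp_in)
    moreover have "?f (v + Poly_Mapping.single i 1) = ?f v + 1"
      using finT that by (simp add: lookup_add sum.distrib lookup_single when_def)
    ultimately show False by simp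
  qed
  then show ?thesis using v(1) that by blast
qed

text \<open>
  The cell containing \<open>v + e\<^sub>G\<close> determines \<open>G\<close>, so at most one of the sets \<open>G \<in> \<G>\<close> below a given
  set \<open>insert k G\<close> owns it, while the exchange property provides at least two of them.
  Hence on average a cell extends in at most half of the directions \<open>W - G\<close>.
\<close>

lemma counting_bound:
  fixes a :: "'i \<Rightarrow> (nat \<Rightarrow>\<^sub>0 nat)" and Z :: "'i \<Rightarrow> nat set" and n :: nat
  defines "e \<equiv> \<lambda>G. pp_of n (\<lambda>i. of_bool (i \<in> G))"
  assumes E: "up_closed n E"
    and cover: "\<And>x. x \<in> E \<Longrightarrow> \<exists>i\<in>I. x \<in> cell (a i) (Z i)"
    and inside: "\<And>i. i \<in> I \<Longrightarrow> cell (a i) (Z i) \<subseteq> E"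
    and disj: "\<And>i j x. \<lbrakk>i \<in> I; j \<in> I; x \<in> cell (a i) (Z i); x \<in> cell (a j) (Z j)\<rbrakk> \<Longrightarrow> i = j"
    and dim: "\<And>i. i \<in> I \<Longrightarrow> Z i \<subseteq> {1..n} \<and> d \<le> card (Z i)"
    and W: "W \<subseteq> {1..n}" and v: "v \<in> pp_in {1..n}"
    and ne: "\<G> \<noteq> {}"
    and gen: "\<And>G. G \<in> \<G> \<Longrightarrow> G \<subseteq> W \<and> card G = g \<and> v + e G \<in> E"
    and min: "\<And>G x. G \<in> \<G> \<Longrightarrow> x \<in> G \<Longrightarrow> v + e (G - {x}) \<notin> E"
    and exch: "\<And>G k. G \<in> \<G> \<Longrightarrow> k \<in> W - G \<Longrightarrow> \<exists>x\<in>G. insert k (G - {x}) \<in> \<G>"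
  shows "2 * d + card W \<le> 2 * n + g"
proof -
  have fin: "finite W" "finite \<G>"
    using W gen finite_subset[of W "{1..n}"] finite_subset[of \<G> "Pow W"] by auto
  have "\<forall>G\<in>\<G>. \<exists>i\<in>I. v + e G \<in> cell (a i) (Z i)" using cover gen by blast
  then obtain f where f: "\<And>G. G \<in> \<G> \<Longrightarrow> f G \<in> I" "\<And>G. G \<in> \<G> \<Longrightarrow> v + e G \<in> cell (a (f G)) (Z (f G))"
    by metis
  have lookup_e: "lookup (e G) y = of_bool (y \<in> G \<and> y \<in> {1..n})" for G y
    by (simp add: e_def lookup_pp_of)
  have le: "lookup (a (f G)) y \<le> lookup v y + lookup (e G) y" if "G \<in> \<G>" for G y
    using f(2)[OF that] by (simp add: in_cell_iff lookup_add)
  \<comment> \<open>Were the base of the cell not above \<open>v\<close> in a direction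
    \<open>x\<close> of \<open>G\<close>, it would lie below \<open>v + e (G - {x})\<close> and
    force that exponent into \<open>E\<close>, against minimality.\<close>
  have G_eq: "G = {x. lookup v x < lookup (a (f G)) x}" if G: "G \<in> \<G>" for G
  proof (intro equalityI subsetI CollectI)
    fix x assume x: "x \<in> G"
    show "lookup v x < lookup (a (f G)) x"
    proof (rule ccontr)
      assume "\<not> lookup v x < lookup (a (f G)) x"
      then have "lookup (a (f G)) y \<le> lookup (v + e (G - {x})) y" for y
        using le[OF G, of y] by (cases "y = x") (simp_all add: lookup_add lookup_e)
      moreover have "a (f G) \<in> E" using inside f(1) G base_in_cell by blast
      moreover have "v + e (G - {x}) \<in> pp_in {1..n}"
        unfolding e_def using v pp_of_in_pp_in by (rule pp_in_add)
      ultimately show False using up_closedD[OF E] min[OF G x] by blast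
    qed
  next
    fix x assume x: "x \<in> {x. lookup v x < lookup (a (f G)) x}"
    then show "x \<in> G" using le[OF G, of x] by (cases "x \<in> G") (simp_all add: lookup_e)
  qed
  have next_in: "v + e (insert k G) \<in> cell (a (f G)) (Z (f G))" if "G \<in> \<G>" "k \<in> Z (f G)" for G k
  proof -
    have "lookup (a (f G)) i \<le> lookup (v + e (insert k G)) i \<and>
      (i \<notin> Z (f G) \<longrightarrow> lookup (v + e (insert k G)) i = lookup (a (f G)) i)" for i
    proof -
      have "i \<notin> Z (f G) \<Longrightarrow> lookup (v + e (insert k G)) i = lookup (v + e G) i"
        using that(2) by (auto simp: lookup_add lookup_e)
      moreover have "lookup (v + e G) i \<le> lookup (v + e (insert k G)) i"
        by (simp add: lookup_add lookup_e)
      moreover have "lookup (a (f G)) i \<le> lookup (v + e G) i"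
        "i \<notin> Z (f G) \<Longrightarrow> lookup (v + e G) i = lookup (a (f G)) i"
        using f(2)[OF that(1)] unfolding in_cell_iff by blast+
      ultimately show ?thesis by linarith
    qed
    then show ?thesis by (simp add: in_cell_iff)
  qed
  \<comment> \<open>\<open>P\<close> collects all one-step extensions of the sets in
    \<open>\<G>\<close>, and \<open>C\<close> those that are realised inside the cell of the set
    being extended.\<close>
  define P where "P = Sigma \<G> (\<lambda>G. W - G)"
  define C where "C = Sigma \<G> (\<lambda>G. (W - G) \<inter> Z (f G))"
  have finP: "finite P" using fin by (auto simp: P_def)
  have CP: "C \<subseteq> P" by (auto simp: C_def P_def)
  \<comment> \<open>The extended exponent lies in one cell only; this cell determines
    \<open>G\<close>, and then \<open>k\<close> is the remaining element.\<close>
  have own: "G = G' \<and> k = k'"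
    if "(G, k) \<in> C" "(G', k') \<in> C" "insert k G = insert k' G'" for G k G' k'
  proof -
    have "v + e (insert k G) \<in> cell (a (f G)) (Z (f G))"
      "v + e (insert k G) \<in> cell (a (f G')) (Z (f G'))"
      using that next_in[of G k] next_in[of G' k'] by (auto simp: C_def)
    then have "f G = f G'" using that disj f(1) by (auto simp: C_def)
    then have "G = G'" using G_eq that by (metis C_def mem_Sigma_iff)
    then show ?thesis using that by (auto simp: C_def)
  qed
  have "\<forall>p\<in>P. \<exists>x. x \<in> fst p \<and> insert (snd p) (fst p - {x}) \<in> \<G>"
    using exch by (auto simp: P_def)
  then obtain x where x: "\<And>G k. (G, k) \<in> P \<Longrightarrow> x (G, k) \<in> G \<and> insert k (G - {x (G, k)}) \<in> \<G>"
    by (metis fst_conv snd_conv)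
  \<comment> \<open>The exchange property yields another pair with the same union but a different
    last element. By uniqueness of the owner, such a swap of a pair in \<open>C\<close> leaves
    \<open>C\<close>, so \<open>C\<close> is at most half of \<open>P\<close>.\<close>
  define \<sigma> where "\<sigma> p = (insert (snd p) (fst p - {x p}), x p)" for p
  have \<sigma>: "\<sigma> p \<in> P" "insert (snd (\<sigma> p)) (fst (\<sigma> p)) = insert (snd p) (fst p)" "snd (\<sigma> p) \<noteq> snd p"
    if "p \<in> P" for p
    using x[of "fst p" "snd p"] that gen[of "fst p"] by (auto simp: P_def \<sigma>_def)
  have inj: "inj_on \<sigma> C"
  proof (rule inj_onI)
    fix p q assume "p \<in> C" "q \<in> C" "\<sigma> p = \<sigma> q"
    then show "p = q"
      using \<sigma>(2)[of p] \<sigma>(2)[of q] own[of "fst p" "snd p" "fst q" "snd q"] CP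
      by (auto simp: prod_eq_iff)
  qed
  have "\<sigma> ` C \<inter> C = {}"
  proof (intro equals0I, elim IntE imageE)
    fix q p assume "q \<in> C" "q = \<sigma> p" "p \<in> C"
    then show False
      using \<sigma>(2,3)[of p] own[of "fst p" "snd p" "fst q" "snd q"] CP by auto
  qed
  moreover have "\<sigma> ` C \<subseteq> P" using \<sigma>(1) CP by auto
  ultimately have "card (\<sigma> ` C) + card C \<le> card P"
    using finP CP by (metis card_Un_disjoint card_mono finite_subset le_sup_iff)
  then have "2 * card C \<le> card P" using inj by (simp add: card_image)
  moreover have cWG: "card (W - G) + g = card W" if "G \<in> \<G>" for G
    using gen[OF that] fin(1)
    by (metis add.commute card_Diff_subset card_mono finite_subset le_add_diff_inverse)
  then have "(\<Sum>G\<in>\<G>. card (W - G) + g) = (\<Sum>G\<in>\<G>. card W)" by (intro sum.cong) auto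
  then have "card P + card \<G> * g = card \<G> * card W"
    using fin by (simp add: P_def sum.distrib)
  \<comment> \<open>Of the at least \<open>d\<close> free directions of a cell, at most
    \<open>n - card (W - G)\<close> lie outside \<open>W - G\<close>. The estimate is kept additive
    to avoid truncated subtraction.\<close>
  moreover have "card \<G> * (d + card W) \<le> card C + card \<G> * (n + g)"
  proof -
    have "d + card W \<le> card ((W - G) \<inter> Z (f G)) + (n + g)" if "G \<in> \<G>" for G
    proof -
      have Z: "Z (f G) \<subseteq> {1..n}" "d \<le> card (Z (f G))" using dim f(1) that by auto
      have "card (Z (f G)) \<le> card ((W - G) \<inter> Z (f G)) + card ({1..n} - (W - G))"
        using Z(1) fin(1) by (intro order_trans[OF card_mono card_Un_le]) auto
      moreover have "card ({1..n} - (W - G)) + card (W - G) = n"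
      proof -
        have "W - G \<subseteq> {1..n}" using W by blast
        then show ?thesis using fin(1) card_mono[of "{1..n}" "W - G"]
          by (subst card_Diff_subset) auto
      qed
      ultimately show ?thesis using cWG[OF that] Z(2) by linarith
    qed
    then have "(\<Sum>G\<in>\<G>. d + card W) \<le> (\<Sum>G\<in>\<G>. card ((W - G) \<inter> Z (f G)) + (n + g))"
      by (rule sum_mono)
    then show ?thesis using fin by (simp add: C_def sum.distrib)
  qed
  ultimately have "card \<G> * (2 * d + card W) \<le> card \<G> * (2 * n + g)"
    by (simp add: algebra_simps)
  moreover have "0 < card \<G>" using fin ne by (simp add: card_gt_0_iff)
  ultimately show ?thesis by simp
qed

section \<open>Monomial ideals as sets of exponents\<close>

text \<open>For upward closed \<open>E\<close> these are exactly the monomial ideals, so ideals can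
  be replaced by their sets of exponents.\<close>

definition spanned :: "(nat \<Rightarrow>\<^sub>0 nat) set \<Rightarrow> 'k::field mpoly set" where
  "spanned E = {f. Poly_Mapping.keys f \<subseteq> E}"

lemma carrier_poly_ring: "carrier (poly_ring n) = spanned (pp_in {1..n})"
  by (simp add: poly_ring_def polys_in_def spanned_def)

lemma poly_ring_ops:
  "f \<otimes>\<^bsub>poly_ring n\<^esub> g = f * g" "f \<oplus>\<^bsub>poly_ring n\<^esub> g = f + g"
  "\<one>\<^bsub>poly_ring n\<^esub> = 1" "\<zero>\<^bsub>poly_ring n\<^esub> = 0"
  by (simp_all add: poly_ring_def)

lemma mon_in_spanned_iff: "mon a \<in> (spanned E :: 'k::field mpoly set) \<longleftrightarrow> a \<in> E"
  by (simp add: mon_def spanned_def)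

lemma spanned_add: "f \<in> spanned E \<Longrightarrow> g \<in> spanned E \<Longrightarrow> f + g \<in> spanned E"
  using keys_add[of f g] by (auto simp: spanned_def)

lemma spanned_uminus: "f \<in> spanned E \<Longrightarrow> - f \<in> spanned E"
  by (simp add: spanned_def)

lemma spanned_zero: "0 \<in> spanned E"
  by (simp add: spanned_def)

lemma spanned_sum: "(\<And>i. i \<in> I \<Longrightarrow> f i \<in> spanned E) \<Longrightarrow> (\<Sum>i\<in>I. f i) \<in> spanned E"
  by (induction I rule: infinite_finite_induct) (auto intro: spanned_add spanned_zero)

lemma spanned_mult:
  assumes "\<And>a b. a \<in> E \<Longrightarrow> b \<in> F \<Longrightarrow> a + b \<in> G" "f \<in> spanned E" "g \<in> spanned F"
  shows "f * g \<in> spanned G"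
  using keys_mult[of f g] assms unfolding spanned_def by blast

lemma poly_mapping_sum_keys:
  "f = (\<Sum>a\<in>Poly_Mapping.keys f. Poly_Mapping.single a (lookup f a))"
  by (intro poly_mapping_eqI) (simp add: lookup_sum lookup_single when_def in_keys_iff)

lemma ring_poly_ring: "ring (poly_ring n :: 'k::field mpoly ring)"
proof (intro ringI abelian_groupI monoidI)
  fix x :: "'k mpoly" assume "x \<in> carrier (poly_ring n)"
  then show "\<exists>y\<in>carrier (poly_ring n). y \<oplus>\<^bsub>poly_ring n\<^esub> x = \<zero>\<^bsub>poly_ring n\<^esub>"
    by (intro bexI[of _ "- x"]) (auto simp: carrier_poly_ring poly_ring_ops intro: spanned_uminus)
qed (auto simp: carrier_poly_ring poly_ring_ops algebra_simps spanned_zero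
    intro: spanned_add spanned_mult pp_in_add, auto simp: spanned_def in_pp_in_iff)

lemma ideal_spanned:
  assumes "up_closed n E"
  shows "ideal (spanned E :: 'k::field mpoly set) (poly_ring n)"
proof (rule idealI[OF ring_poly_ring])
  interpret ring "poly_ring n :: 'k mpoly ring" by (rule ring_poly_ring)
  have inv: "\<ominus>\<^bsub>poly_ring n\<^esub> f = - f" if "f \<in> spanned E" for f :: "'k mpoly"
  proof (rule minus_equality)
    show "f \<in> carrier (poly_ring n)" "- f \<in> carrier (poly_ring n)"
      using that assms by (auto simp: carrier_poly_ring up_closed_def spanned_def)
  qed (simp add: poly_ring_ops)
  show "subgroup (spanned E :: 'k mpoly set) (add_monoid (poly_ring n))"
  proof (rule add.subgroupI)
    show "spanned E \<subseteq> carrier (poly_ring n)"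
      using assms by (auto simp: carrier_poly_ring up_closed_def spanned_def)
    show "spanned E \<noteq> {}" using spanned_zero by blast
    show "\<ominus>\<^bsub>poly_ring n\<^esub> f \<in> spanned E" if "f \<in> spanned E" for f :: "'k mpoly"
      using inv[OF that] that by (simp add: spanned_uminus)
    show "f \<oplus>\<^bsub>poly_ring n\<^esub> g \<in> spanned E" if "f \<in> spanned E" "g \<in> spanned E" for f g :: "'k mpoly"
      using that by (simp add: poly_ring_ops spanned_add)
  qed
  fix f g :: "'k mpoly" assume "f \<in> spanned E" "g \<in> carrier (poly_ring n)"
  then have "f * g \<in> spanned E"
    using assms by (intro spanned_mult[of E "pp_in {1..n}"]) (auto simp: up_closed_def carrier_poly_ring)
  then show "g \<otimes>\<^bsub>poly_ring n\<^esub> f \<in> spanned E" "f \<otimes>\<^bsub>poly_ring n\<^esub> g \<in> spanned E"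
    by (simp_all add: poly_ring_ops mult.commute)
qed

lemma ideal_mult_poly_ring:
  assumes "ideal I (poly_ring n)" "f \<in> I" "g \<in> carrier (poly_ring n)"
  shows "f * g \<in> I"
  using ideal.I_r_closed[OF assms] by (simp add: poly_ring_ops)

lemma ideal_sum_poly_ring:
  assumes "ideal J (poly_ring n)" "\<And>i. i \<in> I \<Longrightarrow> f i \<in> J"
  shows "(\<Sum>i\<in>I. f i) \<in> J"
proof -
  interpret ideal J "poly_ring n" by fact
  have "0 \<in> J" "\<And>f g. f \<in> J \<Longrightarrow> g \<in> J \<Longrightarrow> f + g \<in> J"
    using additive_subgroup.zero_closed[OF is_additive_subgroup]
      additive_subgroup.a_closed[OF is_additive_subgroup] by (simp_all add: poly_ring_ops)
  then show ?thesis using assms(2) by (induction I rule: infinite_finite_induct) auto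
qed

lemma up_closed_cells:
  assumes "B \<subseteq> pp_in {1..n}"
  shows "up_closed n (\<Union>b\<in>B. cell b {1..n})"
  unfolding up_closed_def cell_def using assms by (auto simp: add.assoc intro!: pp_in_add)

text \<open>The multiples of the generators span an ideal; conversely each single term of a
  polynomial in this span is a multiple of one generator.\<close>

lemma ideal_generated_by_monomials:
  assumes "B \<subseteq> pp_in {1..n}"
  shows "Idl\<^bsub>poly_ring n\<^esub> (mon ` B) = (spanned (\<Union>b\<in>B. cell b {1..n}) :: 'k::field mpoly set)"
proof
  let ?E = "\<Union>b\<in>B. cell b {1..n}"
  interpret ring "poly_ring n :: 'k mpoly ring" by (rule ring_poly_ring)
  have "up_closed n ?E" using assms by (rule up_closed_cells)
  then show "Idl\<^bsub>poly_ring n\<^esub> (mon ` B) \<subseteq> (spanned ?E :: 'k mpoly set)"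
    by (intro genideal_minimal ideal_spanned)
      (auto simp: mon_in_spanned_iff intro!: base_in_cell)
  have sub: "mon ` B \<subseteq> carrier (poly_ring n :: 'k mpoly ring)"
    using assms by (auto simp: carrier_poly_ring mon_in_spanned_iff)
  let ?J = "Idl\<^bsub>poly_ring n\<^esub> (mon ` B) :: 'k mpoly set"
  have J: "ideal ?J (poly_ring n)" by (rule genideal_ideal[OF sub])
  show "spanned ?E \<subseteq> ?J"
  proof
    fix f :: "'k mpoly" assume f: "f \<in> spanned ?E"
    have "(\<Sum>a\<in>Poly_Mapping.keys f. Poly_Mapping.single a (lookup f a)) \<in> ?J"
    proof (rule ideal_sum_poly_ring[OF J])
      fix a assume "a \<in> Poly_Mapping.keys f"
      then obtain b c where "b \<in> B" "a = b + c" "c \<in> pp_in {1..n}"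
        using f by (auto simp: spanned_def cell_def)
      moreover have "Poly_Mapping.single (b + c) (lookup f a) = mon b * Poly_Mapping.single c (lookup f a)"
        by (simp add: mon_def mult_single)
      ultimately show "Poly_Mapping.single a (lookup f a) \<in> ?J"
        using genideal_self[OF sub]
        by (auto intro!: ideal_mult_poly_ring[OF J] simp: carrier_poly_ring spanned_def)
    qed
    then show "f \<in> ?J" using poly_mapping_sum_keys by metis
  qed
qed

text \<open>An upward closed set is the union of the full cells at its own elements, so all its
  monomials together serve as generators.\<close>

lemma monomial_ideal_iff:
  "monomial_ideal n (I :: 'k::field mpoly set) \<longleftrightarrow> (\<exists>E. up_closed n E \<and> I = spanned E)"
proof
  assume "monomial_ideal n I"
  then obtain A where "A \<subseteq> mon ` pp_in {1..n}" "I = Idl\<^bsub>poly_ring n\<^esub> A"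
    unfolding monomial_ideal_def by blast
  then obtain B where B: "B \<subseteq> pp_in {1..n}" "I = Idl\<^bsub>poly_ring n\<^esub> (mon ` B)"
    by (metis subset_imageE)
  moreover have "up_closed n (\<Union>b\<in>B. cell b {1..n})"
    using B(1) by (rule up_closed_cells)
  ultimately show "\<exists>E. up_closed n E \<and> I = spanned E"
    using ideal_generated_by_monomials by metis
next
  assume "\<exists>E. up_closed n E \<and> I = spanned E"
  then obtain E where E: "up_closed n E" "I = spanned E" by blast
  then have "E = (\<Union>b\<in>E. cell b {1..n})"
    unfolding up_closed_def cell_def by (auto intro: bexI[of _ "0"] simp: in_pp_in_iff image_iff)
  then have "I = Idl\<^bsub>poly_ring n\<^esub> (mon ` E)"
    using E ideal_generated_by_monomials[of E n, where 'k = 'k] by (simp add: up_closed_def)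
  moreover have "mon ` E \<subseteq> mon ` pp_in {1..n}" using E(1) by (auto simp: up_closed_def)
  ultimately show "monomial_ideal n I" unfolding monomial_ideal_def by blast
qed

lemma mon_mult: "mon (a + b) = mon a * mon b"
  by (simp add: mon_def mult_single)

lemma mon_zero: "mon 0 = 1"
  by (simp add: mon_def)

lemma ideal_generated_by_variables:
  assumes "T \<subseteq> {1..n}"
  shows "Idl\<^bsub>poly_ring n\<^esub> (var ` T) =
    (spanned {a \<in> pp_in {1..n}. \<exists>i\<in>T. 0 < lookup a i} :: 'k::field mpoly set)"
proof -
  let ?B = "(\<lambda>i. Poly_Mapping.single i 1) ` T"
  have "(\<Union>b\<in>?B. cell b {1..n}) = {a \<in> pp_in {1..n}. \<exists>i\<in>T. 0 < lookup a i}"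
  proof (intro equalityI subsetI)
    fix a assume "a \<in> {a \<in> pp_in {1..n}. \<exists>i\<in>T. 0 < lookup a i}"
    then obtain i where "a \<in> pp_in {1..n}" "i \<in> T" "0 < lookup a i" by blast
    then have "a \<in> cell (Poly_Mapping.single i 1) {1..n}"
      using assms by (auto simp: in_cell_iff in_pp_in_iff lookup_single when_def)
    then show "a \<in> (\<Union>b\<in>?B. cell b {1..n})" using \<open>i \<in> T\<close> by blast
  next
    fix a assume "a \<in> (\<Union>b\<in>?B. cell b {1..n})"
    then obtain i where i: "i \<in> T" "a \<in> cell (Poly_Mapping.single i 1) {1..n}" by blast
    then have "0 < lookup a i" by (auto simp: in_cell_iff dest!: spec[of _ i])
    moreover have "a \<in> pp_in {1..n}"
      using i assms unfolding cell_def by (auto intro!: pp_in_add single_in_pp_in)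
    ultimately show "a \<in> {a \<in> pp_in {1..n}. \<exists>i\<in>T. 0 < lookup a i}" using i by blast
  qed
  moreover have "var ` T = mon ` ?B" by (auto simp: var_def)
  moreover have "?B \<subseteq> pp_in {1..n}" using assms by (auto intro: single_in_pp_in)
  ultimately show ?thesis using ideal_generated_by_monomials by metis
qed

section \<open>Stanley decompositions of monomial ideals\<close>

lemma subspace_spanned: "kvs.subspace (spanned E :: 'k::field mpoly set)"
proof (rule kvs.subspaceI)
  fix c and f :: "'k mpoly" assume "f \<in> spanned E"
  then show "kscale c f \<in> spanned E"
    unfolding kscale_def by (intro spanned_mult[of "{0}" E]) (auto simp: spanned_def)
qed (auto intro: spanned_zero spanned_add)

text \<open>This translates Stanley spaces into cells: up to the nonzero scalar \<open>c\<close>,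
  the generators are the monomials with exponents in the cell.\<close>

lemma gen_space_single:
  assumes "c \<noteq> (0::'k::field)"
  shows "gen_space (Poly_Mapping.single a c) Z = spanned (cell a Z)"
proof
  let ?G = "(\<lambda>b. Poly_Mapping.single a c * mon b) ` pp_in Z"
  have "?G \<subseteq> spanned (cell a Z)"
    using assms by (auto simp: mon_def mult_single spanned_def cell_def)
  then show "gen_space (Poly_Mapping.single a c) Z \<subseteq> spanned (cell a Z)"
    unfolding gen_space_def using subspace_spanned by (rule kvs.span_minimal)
  show "spanned (cell a Z) \<subseteq> gen_space (Poly_Mapping.single a c) Z"
  proof
    fix f :: "'k mpoly" assume f: "f \<in> spanned (cell a Z)"
    have "(\<Sum>b\<in>Poly_Mapping.keys f. Poly_Mapping.single b (lookup f b)) \<in> kvs.span ?G"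
    proof (rule kvs.span_sum)
      fix b assume "b \<in> Poly_Mapping.keys f"
      then obtain b' where b': "b = a + b'" "b' \<in> pp_in Z" using f by (auto simp: spanned_def cell_def)
      have "Poly_Mapping.single b (lookup f b) =
        kscale (lookup f b / c) (Poly_Mapping.single a c * mon b')"
        using assms b'(1) by (simp add: kscale_def mon_def mult_single)
      then show "Poly_Mapping.single b (lookup f b) \<in> kvs.span ?G"
        by (simp only:) (intro kvs.span_scale kvs.span_base imageI b'(2))
    qed
    then show "f \<in> gen_space (Poly_Mapping.single a c) Z"
      unfolding gen_space_def using poly_mapping_sum_keys by metis
  qed
qed

text \<open>The generator alone is a basis: every element of the space is divisible by
  \<open>mon a\<close>, and the quotient is unique by cancellation.\<close>

lemma free_over_monomial: "free_over (polys_in Z) (gen_space (mon a :: 'k::field mpoly) Z)"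
  unfolding free_over_def
proof (intro exI[of _ "{mon a}"] conjI ballI)
  have gen: "gen_space (mon a :: 'k mpoly) Z = spanned (cell a Z)"
    unfolding mon_def by (simp add: gen_space_single)
  show "{mon a} \<subseteq> gen_space (mon a :: 'k mpoly) Z"
    unfolding gen by (simp add: mon_in_spanned_iff base_in_cell)
  have mon: "mon a \<noteq> (0 :: 'k mpoly)" by (simp add: mon_def flip: keys_eq_empty)
  fix v :: "'k mpoly" assume v: "v \<in> gen_space (mon a) Z"
  \<comment> \<open>The quotient of \<open>v\<close> by \<open>mon a\<close>, formed term by
    term.\<close>
  define q where "q = (\<Sum>b\<in>Poly_Mapping.keys v. Poly_Mapping.single (b - a) (lookup v b))"
  have cell: "a + (b - a) = b" "b - a \<in> pp_in Z" if "b \<in> Poly_Mapping.keys v" for b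
    using v that by (auto simp: gen spanned_def cell_def)
  have "mon a * q = (\<Sum>b\<in>Poly_Mapping.keys v. Poly_Mapping.single b (lookup v b))"
    unfolding q_def sum_distrib_left by (intro sum.cong) (simp_all add: cell mon_def mult_single)
  then have q: "q * mon a = v" using poly_mapping_sum_keys[of v] by (simp add: mult.commute)
  have qZ: "q \<in> polys_in Z"
    unfolding q_def polys_in_def spanned_def[symmetric] using cell
    by (intro spanned_sum) (auto simp: spanned_def)
  let ?P = "\<lambda>c. range c \<subseteq> polys_in Z \<and> finite {b. c b \<noteq> 0} \<and> {b. c b \<noteq> 0} \<subseteq> {mon a} \<and>
    v = (\<Sum>b | c b \<noteq> 0. c b * b)"
  have sum: "(\<Sum>b | c b \<noteq> 0. c b * b) = c (mon a) * mon a" if "{b. c b \<noteq> 0} \<subseteq> {mon a}"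
    for c :: "'k mpoly \<Rightarrow> 'k mpoly"
    using that by (subst sum.mono_neutral_left[of "{mon a}"]) auto
  show "\<exists>!c. ?P c"
  proof (rule ex1I[of _ "\<lambda>b. if b = mon a then q else 0"])
    have "{b. (if b = mon a then q else 0) \<noteq> 0} \<subseteq> {mon a}" by auto
    then show "?P (\<lambda>b. if b = mon a then q else 0)"
      using q qZ by (subst sum) (auto simp: polys_in_def intro: finite_subset)
  next
    fix c assume c: "?P c"
    then have "c (mon a) * mon a = q * mon a" using sum[of c] q by metis
    then have "c (mon a) = q" using mon by simp
    moreover have "c b = 0" if "b \<noteq> mon a" for b using c that by blast
    ultimately show "c = (\<lambda>b. if b = mon a then q else 0)" by auto
  qed
qed

text \<open>The three parts of the direct sum condition become conditions on cells: surjectivity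
  means covering, values in the ideal mean containment, and injectivity means disjointness.\<close>

lemma stanley_decomposition_cells:
  fixes D :: "('k::field mpoly \<times> nat set) list"
  assumes "stanley_decomposition n (spanned E) D"
  obtains a where
    "\<And>x. x \<in> E \<Longrightarrow> \<exists>i\<in>{..<length D}. x \<in> cell (a i) (snd (D ! i))"
    "\<And>i. i \<in> {..<length D} \<Longrightarrow> cell (a i) (snd (D ! i)) \<subseteq> E"
    "\<And>i j x. \<lbrakk>i \<in> {..<length D}; j \<in> {..<length D}; x \<in> cell (a i) (snd (D ! i));
       x \<in> cell (a j) (snd (D ! j))\<rbrakk> \<Longrightarrow> i = j"
    "\<And>i. i \<in> {..<length D} \<Longrightarrow> snd (D ! i) \<subseteq> {1..n}"
proof -
  let ?I = "{..<length D}"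
  let ?V = "\<lambda>i. gen_space (fst (D ! i)) (snd (D ! i))"
  have space: "stanley_space n (spanned E) (D ! i)" if "i \<in> ?I" for i
    using assms that by (auto simp: stanley_decomposition_def)
  have "\<exists>a c. fst (D ! i) = Poly_Mapping.single a c \<and> c \<noteq> 0" if "i \<in> ?I" for i
  proof -
    have "homogeneous (fst (D ! i))" "fst (D ! i) \<noteq> 0"
      using space[OF that] by (auto simp: stanley_space_def split: prod.splits)
    then obtain a c where "fst (D ! i) = Poly_Mapping.single a c" by (auto simp: homogeneous_def)
    moreover from this have "c \<noteq> 0" using \<open>fst (D ! i) \<noteq> 0\<close> by auto
    ultimately show ?thesis by blast
  qed
  then obtain a c where ac: "\<And>i. i \<in> ?I \<Longrightarrow> fst (D ! i) = Poly_Mapping.single (a i) (c i) \<and> c i \<noteq> 0"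
    by metis
  have V: "?V i = spanned (cell (a i) (snd (D ! i)))" if "i \<in> ?I" for i
    using ac[OF that] by (simp add: gen_space_single)
  let ?sum = "\<lambda>v. \<Sum>i<length D. v i"
  have bij: "bij_betw ?sum (Pi\<^sub>E ?I ?V) (spanned E)"
    using assms by (simp add: stanley_decomposition_def)
  \<comment> \<open>The tuple with \<open>mon x\<close> in position \<open>i\<close> and zero
    elsewhere. A monomial in two cells would be the sum of two different such tuples.\<close>
  define pt where "pt i x = (\<lambda>j\<in>?I. if j = i then mon x else (0 :: 'k mpoly))" for i and x :: "nat \<Rightarrow>\<^sub>0 nat"
  have pt: "pt i x \<in> Pi\<^sub>E ?I ?V" if "i \<in> ?I" "x \<in> cell (a i) (snd (D ! i))" for i x
    using that by (auto simp: pt_def V mon_in_spanned_iff spanned_zero)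
  have sum_pt: "?sum (pt i x) = mon x" if "i \<in> ?I" for i x
    using that by (simp add: pt_def)
  have mon: "mon x \<noteq> (0 :: 'k mpoly)" for x by (simp add: mon_def flip: keys_eq_empty)
  show thesis
  proof (rule that[of a])
    fix x assume "x \<in> E"
    then have "mon x \<in> ?sum ` Pi\<^sub>E ?I ?V"
      using bij by (simp add: bij_betw_def mon_in_spanned_iff)
    then obtain v where v: "v \<in> Pi\<^sub>E ?I ?V" "mon x = ?sum v" by blast
    \<comment> \<open>No cancellation can create an exponent, so \<open>x\<close> already occurs in
      one of the summands.\<close>
    have "x \<in> Poly_Mapping.keys (?sum v)" unfolding v(2)[symmetric] by (simp add: mon_def)
    then obtain i where "i \<in> ?I" "x \<in> Poly_Mapping.keys (v i)"
      by (auto simp: in_keys_iff lookup_sum elim!: sum.not_neutral_contains_not_neutral)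
    moreover have "v i \<in> spanned (cell (a i) (snd (D ! i)))"
      using v(1) V[OF \<open>i \<in> ?I\<close>] \<open>i \<in> ?I\<close> by (auto simp: PiE_iff)
    ultimately show "\<exists>i\<in>?I. x \<in> cell (a i) (snd (D ! i))" by (auto simp: spanned_def)
  next
    fix i assume i: "i \<in> ?I"
    show "cell (a i) (snd (D ! i)) \<subseteq> E"
    proof
      fix x assume "x \<in> cell (a i) (snd (D ! i))"
      then have "?sum (pt i x) \<in> spanned E" using bij pt[OF i] by (auto simp: bij_betw_def)
      then show "x \<in> E" by (simp add: sum_pt[OF i] mon_in_spanned_iff)
    qed
    show "snd (D ! i) \<subseteq> {1..n}"
      using space[OF i] by (auto simp: stanley_space_def split: prod.splits)
  next
    fix i j x
    assume ij: "i \<in> ?I" "j \<in> ?I" and x: "x \<in> cell (a i) (snd (D ! i))" "x \<in> cell (a j) (snd (D ! j))"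
    have "?sum (pt i x) = ?sum (pt j x)" using sum_pt ij by simp
    then have "pt i x = pt j x"
      using bij pt ij x unfolding bij_betw_def by (blast dest: inj_onD)
    then have "pt i x i = pt j x i" by simp
    then show "i = j" using ij mon[of x] by (auto simp: pt_def split: if_splits)
  qed
qed

section \<open>From partitions into cells back to Stanley decompositions\<close>

lemma celled_list:
  assumes "celled n k E"
  obtains cs where "E = (\<Union>(a, Z)\<in>set cs. cell a Z)"
    "\<And>a Z. (a, Z) \<in> set cs \<Longrightarrow> Z \<subseteq> {1..n} \<and> k \<le> card Z"
    "sorted_wrt (\<lambda>(a, Z) (b, Y). cell a Z \<inter> cell b Y = {}) cs"
proof -
  have "\<exists>cs. E = (\<Union>(a, Z)\<in>set cs. cell a Z) \<and> (\<forall>(a, Z)\<in>set cs. Z \<subseteq> {1..n} \<and> k \<le> card Z) \<and>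
    sorted_wrt (\<lambda>(a, Z) (b, Y). cell a Z \<inter> cell b Y = {}) cs"
    using assms
  proof (induction rule: celled.induct)
    case celled_empty
    then show ?case by (intro exI[of _ "[]"]) auto
  next
    case (celled_cell E Z a)
    then obtain cs where "E = (\<Union>(a, Z)\<in>set cs. cell a Z) \<and> (\<forall>(a, Z)\<in>set cs. Z \<subseteq> {1..n} \<and> k \<le> card Z) \<and>
      sorted_wrt (\<lambda>(a, Z) (b, Y). cell a Z \<inter> cell b Y = {}) cs" by blast
    then show ?case using celled_cell(2-4) by (intro exI[of _ "(a, Z) # cs"]) auto
  qed
  then show thesis using that by blast
qed

definition restrict_poly :: "(nat \<Rightarrow>\<^sub>0 nat) set \<Rightarrow> 'k::field mpoly \<Rightarrow> 'k mpoly" where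
  "restrict_poly A f = (\<Sum>a\<in>Poly_Mapping.keys f \<inter> A. Poly_Mapping.single a (lookup f a))"

lemma lookup_restrict_poly: "lookup (restrict_poly A f) a = (if a \<in> A then lookup f a else 0)"
  by (auto simp: restrict_poly_def lookup_sum lookup_single when_def in_keys_iff)

lemma restrict_poly_in_spanned: "restrict_poly A f \<in> spanned A"
  by (auto simp: spanned_def in_keys_iff lookup_restrict_poly split: if_splits)

lemma lookup_outside: "f \<in> spanned A \<Longrightarrow> a \<notin> A \<Longrightarrow> lookup f a = 0"
  by (auto simp: spanned_def in_keys_iff)

text \<open>The inverse cuts a polynomial into its restrictions to the sets \<open>C i\<close>;
  disjointness makes each term go to one summand only.\<close>

lemma bij_betw_sum_spanned:
  fixes m :: nat
  assumes disj: "\<And>i j x. \<lbrakk>i < m; j < m; x \<in> C i; x \<in> C j\<rbrakk> \<Longrightarrow> i = j"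
  shows "bij_betw (\<lambda>v. \<Sum>i<m. v i) (Pi\<^sub>E {..<m} (\<lambda>i. spanned (C i)))
    (spanned (\<Union>i<m. C i) :: 'k::field mpoly set)"
proof (rule bij_betwI)
  let ?G = "\<lambda>f. \<lambda>i\<in>{..<m}. restrict_poly (C i) f :: 'k mpoly"
  show "(\<lambda>v. \<Sum>i<m. v i) \<in> Pi\<^sub>E {..<m} (\<lambda>i. spanned (C i)) \<rightarrow> (spanned (\<Union>i<m. C i) :: 'k mpoly set)"
    by (intro Pi_I spanned_sum) (auto simp: spanned_def PiE_iff; blast)
  show "?G \<in> spanned (\<Union>i<m. C i) \<rightarrow> Pi\<^sub>E {..<m} (\<lambda>i. spanned (C i))"
    by (simp add: restrict_PiE_iff restrict_poly_in_spanned)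
  fix v assume v: "v \<in> Pi\<^sub>E {..<m} (\<lambda>i. spanned (C i) :: 'k mpoly set)"
  show "?G (\<Sum>i<m. v i) = v"
  proof (rule PiE_ext[of _ "{..<m}" "\<lambda>_. UNIV"])
    fix i assume i: "i \<in> {..<m}"
    have "lookup (?G (\<Sum>i<m. v i) i) x = lookup (v i) x" for x
    proof (cases "x \<in> C i")
      case True
      have "lookup (v j) x = 0" if "j < m" "j \<noteq> i" for j
        using v that True i disj by (intro lookup_outside[of _ "C j"]) auto
      then have "(\<Sum>j<m. lookup (v j) x) = lookup (v i) x"
        using i by (subst sum.remove[of _ i]) auto
      then show ?thesis using i True by (simp add: lookup_restrict_poly lookup_sum)
    next
      case False
      then have "lookup (v i) x = 0" using v i by (intro lookup_outside[of _ "C i"]) auto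
      then show ?thesis using i False by (simp add: lookup_restrict_poly)
    qed
    then show "?G (\<Sum>i<m. v i) i = v i" by (rule poly_mapping_eqI)
  qed (use v in \<open>auto simp: PiE_iff\<close>)
next
  fix f :: "'k mpoly" assume f: "f \<in> spanned (\<Union>i<m. C i)"
  show "(\<Sum>i<m. (\<lambda>i\<in>{..<m}. restrict_poly (C i) f) i) = f"
  proof (rule poly_mapping_eqI)
    fix x
    have "(\<Sum>i<m. if x \<in> C i then lookup f x else 0) = lookup f x"
    proof (cases "\<exists>i<m. x \<in> C i")
      case True
      then obtain i where i: "i < m" "x \<in> C i" by blast
      then have "(\<Sum>j\<in>{..<m} - {i}. if x \<in> C j then lookup f x else 0) = 0"
        using disj by (intro sum.neutral) auto
      then show ?thesis using i by (subst sum.remove[of _ i]) auto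
    next
      case False
      then show ?thesis using lookup_outside[OF f, of x] by auto
    qed
    then show "lookup (\<Sum>i<m. (\<lambda>i\<in>{..<m}. restrict_poly (C i) f) i) x = lookup f x"
      by (simp add: lookup_sum lookup_restrict_poly)
  qed
qed

lemma stanley_decomposition_of_cells:
  assumes "celled n k E"
  obtains D :: "('k::field mpoly \<times> nat set) list" where "stanley_decomposition n (spanned E) D"
    "\<And>w Z. (w, Z) \<in> set D \<Longrightarrow> k \<le> card Z"
proof -
  obtain cs where cs: "E = (\<Union>(a, Z)\<in>set cs. cell a Z)"
    "\<And>a Z. (a, Z) \<in> set cs \<Longrightarrow> Z \<subseteq> {1..n} \<and> k \<le> card Z"
    "sorted_wrt (\<lambda>(a, Z) (b, Y). cell a Z \<inter> cell b Y = {}) cs"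
    using celled_list[OF assms] by metis
  define D where "D = map (\<lambda>(a, Z). (mon a :: 'k mpoly, Z)) cs"
  define C where "C i = cell (fst (cs ! i)) (snd (cs ! i))" for i
  have lt: "C i \<inter> C j = {}" if "i < j" "j < length cs" for i j
    using sorted_wrt_nth_less[OF cs(3) that] by (simp add: C_def split: prod.splits)
  have "i = j" if "i < length cs" "j < length cs" "x \<in> C i" "x \<in> C j" for i j x
    using that lt[of i j] lt[of j i] by (cases i j rule: linorder_cases) auto
  then have "bij_betw (\<lambda>v. \<Sum>i<length cs. v i) (Pi\<^sub>E {..<length cs} (\<lambda>i. spanned (C i)))
    (spanned (\<Union>i<length cs. C i) :: 'k mpoly set)"
    by (rule bij_betw_sum_spanned)
  moreover have "(\<Union>i<length cs. C i) = E"
  proof -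
    have "set cs = (!) cs ` {..<length cs}" by (auto simp: set_conv_nth)
    then show ?thesis unfolding cs(1) C_def by (simp add: case_prod_beta)
  qed
  moreover have "gen_space (fst (D ! i)) (snd (D ! i)) = spanned (C i)" if "i < length cs" for i
    using that by (simp add: D_def C_def mon_def gen_space_single split: prod.splits)
  then have "Pi\<^sub>E {..<length cs} (\<lambda>i. gen_space (fst (D ! i)) (snd (D ! i))) =
    Pi\<^sub>E {..<length cs} (\<lambda>i. spanned (C i))"
    by (intro PiE_cong) auto
  moreover have "stanley_space n (spanned E) (mon a :: 'k mpoly, Z)" if "(a, Z) \<in> set cs" for a Z
  proof -
    have "a \<in> E" using that base_in_cell unfolding cs(1) by fastforce
    moreover have "mon a \<noteq> (0 :: 'k mpoly)" by (simp add: mon_def flip: keys_eq_empty)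
    ultimately show ?thesis
      using cs(2)[OF that] free_over_monomial[of Z a]
      by (auto simp: stanley_space_def mon_in_spanned_iff homogeneous_def) (simp add: mon_def; blast)
  qed
  ultimately have "stanley_decomposition n (spanned E) D"
    unfolding stanley_decomposition_def by (auto simp: D_def)
  moreover have "k \<le> card Z" if "(w, Z) \<in> set D" for w Z
    using that cs(2) by (auto simp: D_def)
  ultimately show thesis using that by blast
qed

section \<open>Existence of the maximum and minimum in the Stanley depth\<close>

lemma decomposition_nonempty:
  fixes D :: "('k::field mpoly \<times> nat set) list"
  assumes "stanley_decomposition n (spanned E) D" "E \<noteq> {}"
  shows "D \<noteq> []"
proof
  assume "D = []"
  obtain x where "x \<in> E" using assms(2) by blast
  then show False
    using assms(1) \<open>D = []\<close> by (elim stanley_decomposition_cells) auto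
qed

lemma finite_sdepths:
  fixes E :: "(nat \<Rightarrow>\<^sub>0 nat) set"
  assumes "E \<noteq> {}"
  shows "finite {sdepth_decomp D | D. stanley_decomposition n (spanned E :: 'k::field mpoly set) D}"
proof (rule finite_subset)
  show "{sdepth_decomp D | D. stanley_decomposition n (spanned E :: 'k mpoly set) D} \<subseteq> {..n}"
  proof
    fix s assume "s \<in> {sdepth_decomp D | D. stanley_decomposition n (spanned E :: 'k mpoly set) D}"
    then obtain D :: "('k mpoly \<times> nat set) list"
      where D: "stanley_decomposition n (spanned E) D" and s: "s = sdepth_decomp D" by blast
    obtain w Z where wZ: "(w, Z) \<in> set D"
      using decomposition_nonempty[OF D assms] by (cases D) auto
    then have "Z \<subseteq> {1..n}" using D by (auto simp: stanley_decomposition_def stanley_space_def)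
    then have "card Z \<le> n" using card_mono[of "{1..n}" Z] by simp
    moreover have "sdepth_decomp D \<le> card Z"
      unfolding sdepth_decomp_def using wZ by (intro Min_le) force+
    ultimately show "s \<in> {..n}" unfolding s by simp
  qed
qed simp

lemma sdepth_ge:
  assumes "celled n k E" "E \<noteq> {}"
  shows "k \<le> sdepth n (spanned E :: 'k::field mpoly set)"
proof -
  obtain D :: "('k mpoly \<times> nat set) list" where D: "stanley_decomposition n (spanned E) D"
    "\<And>w Z. (w, Z) \<in> set D \<Longrightarrow> k \<le> card Z"
    using stanley_decomposition_of_cells[OF assms(1)] by metis
  have "k \<le> sdepth_decomp D"
    unfolding sdepth_decomp_def using decomposition_nonempty[OF D(1) assms(2)] D(2)
    by (intro Min.boundedI) auto
  also have "\<dots> \<le> sdepth n (spanned E :: 'k mpoly set)"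
    unfolding sdepth_def using D(1) by (intro Max_ge finite_sdepths assms(2)) auto
  finally show ?thesis .
qed

text \<open>The given cells provide one decomposition, so the maximum is taken over a nonempty
  finite set; the value of \<open>k\<close> does not enter the conclusion.\<close>

lemma sdepth_attained:
  assumes "celled n k E" "E \<noteq> {}"
  obtains D where "stanley_decomposition n (spanned E :: 'k::field mpoly set) D"
    "sdepth n (spanned E :: 'k mpoly set) = sdepth_decomp D"
proof -
  let ?S = "{sdepth_decomp D | D. stanley_decomposition n (spanned E :: 'k mpoly set) D}"
  have "?S \<noteq> {}" using stanley_decomposition_of_cells[OF assms(1)] by (metis (mono_tags, lifting) empty_iff mem_Collect_eq)
  then have "Max ?S \<in> ?S" by (intro Max_in finite_sdepths assms(2))
  then show thesis using that unfolding sdepth_def by blast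
qed

lemma sdepth_counting_bound:
  assumes E: "up_closed n E" "celled n 0 E"
    and W: "W \<subseteq> {1..n}" and v: "v \<in> pp_in {1..n}"
    and ne: "\<G> \<noteq> {}"
    and gen: "\<And>G. G \<in> \<G> \<Longrightarrow> G \<subseteq> W \<and> card G = g \<and> v + pp_of n (\<lambda>i. of_bool (i \<in> G)) \<in> E"
    and min: "\<And>G x. G \<in> \<G> \<Longrightarrow> x \<in> G \<Longrightarrow> v + pp_of n (\<lambda>i. of_bool (i \<in> G - {x})) \<notin> E"
    and exch: "\<And>G k. G \<in> \<G> \<Longrightarrow> k \<in> W - G \<Longrightarrow> \<exists>x\<in>G. insert k (G - {x}) \<in> \<G>"
  shows "2 * sdepth n (spanned E :: 'k::field mpoly set) + card W \<le> 2 * n + g"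
proof -
  have "E \<noteq> {}" using ne gen by blast
  obtain D where D: "stanley_decomposition n (spanned E :: 'k mpoly set) D"
    "sdepth n (spanned E :: 'k mpoly set) = sdepth_decomp D"
    using sdepth_attained[OF E(2) \<open>E \<noteq> {}\<close>] by metis
  obtain a where a: "\<And>x. x \<in> E \<Longrightarrow> \<exists>i\<in>{..<length D}. x \<in> cell (a i) (snd (D ! i))"
    "\<And>i. i \<in> {..<length D} \<Longrightarrow> cell (a i) (snd (D ! i)) \<subseteq> E"
    "\<And>i j x. \<lbrakk>i \<in> {..<length D}; j \<in> {..<length D}; x \<in> cell (a i) (snd (D ! i));
       x \<in> cell (a j) (snd (D ! j))\<rbrakk> \<Longrightarrow> i = j"
    "\<And>i. i \<in> {..<length D} \<Longrightarrow> snd (D ! i) \<subseteq> {1..n}"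
    using stanley_decomposition_cells[OF D(1)] by blast
  have dim: "snd (D ! i) \<subseteq> {1..n} \<and> sdepth_decomp D \<le> card (snd (D ! i))" if "i \<in> {..<length D}" for i
  proof -
    have "D ! i \<in> set D" using that by simp
    then have "sdepth_decomp D \<le> card (snd (D ! i))"
      unfolding sdepth_decomp_def by (intro Min_le) (auto simp: image_iff split: prod.splits intro!: bexI[of _ "D ! i"])
    then show ?thesis using a(4)[OF that] by simp
  qed
  show ?thesis unfolding D(2)
    by (rule counting_bound[where I = "{..<length D}" and a = a and Z = "\<lambda>i. snd (D ! i)"
          and E = E and v = v and \<G> = \<G>])
      (fact E(1) a dim W v ne gen min exch)+
qed

section \<open>Primary and irreducible monomial ideals\<close>

lemma mon_single_power: "mon (Poly_Mapping.single i 1) ^ k = (mon (Poly_Mapping.single i k) :: 'k::field mpoly)"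
proof (induction k)
  case (Suc k)
  then show ?case by (simp add: mon_def mult_single flip: single_add)
qed (simp add: mon_zero)

text \<open>Membership depends only on the exponents of the variables in \<open>T\<close>. For a
  primary monomial ideal with radical generated by these variables, this says that the other
  variables are nonzerodivisors modulo the ideal.\<close>

definition determined_by :: "nat \<Rightarrow> nat set \<Rightarrow> (nat \<Rightarrow>\<^sub>0 nat) set \<Rightarrow> bool" where
  "determined_by n T E \<longleftrightarrow>
    (\<forall>a\<in>E. \<forall>b\<in>pp_in {1..n}. (\<forall>i\<in>T. lookup a i = lookup b i) \<longrightarrow> b \<in> E)"

lemma determined_byD:
  "\<lbrakk>determined_by n T E; a \<in> E; b \<in> pp_in {1..n}; \<And>i. i \<in> T \<Longrightarrow> lookup a i = lookup b i\<rbrakk> \<Longrightarrow> b \<in> E"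
  unfolding determined_by_def by blast

text \<open>A monomial factors into a part in the variables of \<open>T\<close> and a part in the
  others. The latter is not in the radical, so primality up to the radical puts the former into
  \<open>Q\<close>. Powers of the variables in \<open>T\<close> lie in \<open>Q\<close> because the
  variables lie in its radical.\<close>

lemma primary_exponents:
  fixes Q :: "'k::field mpoly set"
  assumes "monomial_ideal n Q" "primary_ideal n Q" "radical n Q = Idl\<^bsub>poly_ring n\<^esub> (var ` T)"
    and T: "T \<subseteq> {1..n}"
  obtains E N where "up_closed n E" "Q = spanned E" "0 \<notin> E"
    "\<And>i M. i \<in> T \<Longrightarrow> N \<le> M \<Longrightarrow> Poly_Mapping.single i M \<in> E"
    "determined_by n T E"
proof -
  obtain E where E: "up_closed n E" "Q = spanned E"
    using assms(1) unfolding monomial_ideal_iff by blast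
  have rad: "radical n Q = spanned {a \<in> pp_in {1..n}. \<exists>i\<in>T. 0 < lookup a i}"
    unfolding assms(3) by (rule ideal_generated_by_variables[OF T])
  have zero: "0 \<notin> E"
  proof
    assume "0 \<in> E"
    then have "b \<in> E" if "b \<in> pp_in {1..n}" for b
      using that by (intro up_closedD[OF E(1) \<open>0 \<in> E\<close>]) auto
    then have "E = pp_in {1..n}" using E(1) unfolding up_closed_def by blast
    then show False using assms(2) E(2) by (simp add: primary_ideal_def carrier_poly_ring)
  qed
  have "\<exists>k. Poly_Mapping.single i k \<in> E" if "i \<in> T" for i
  proof -
    have "var i \<in> radical n Q"
      unfolding rad var_def mon_in_spanned_iff using that T
      by (auto intro!: single_in_pp_in bexI[of _ i])
    then obtain k where "(var i :: 'k mpoly) ^ k \<in> Q" by (auto simp: radical_def)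
    then show ?thesis unfolding var_def mon_single_power E(2) mon_in_spanned_iff by blast
  qed
  then obtain \<kappa> where \<kappa>: "\<And>i. i \<in> T \<Longrightarrow> Poly_Mapping.single i (\<kappa> i) \<in> E" by metis
  have finT: "finite T" using T finite_subset by blast
  show thesis
  proof (rule that[OF E zero])
    \<comment> \<open>The sum of the individual exponents serves as one exponent for all variables
      in \<open>T\<close>.\<close>
    show "Poly_Mapping.single i M \<in> E" if "i \<in> T" "sum \<kappa> T \<le> M" for i M
    proof (rule up_closedD[OF E(1) \<kappa>[OF that(1)]])
      have "\<kappa> i \<le> sum \<kappa> T" using finT that(1) by (intro member_le_sum) auto
      then show "lookup (Poly_Mapping.single i (\<kappa> i)) j \<le> lookup (Poly_Mapping.single i M) j" for j
        using that(2) by (auto simp: lookup_single when_def)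
      show "Poly_Mapping.single i M \<in> pp_in {1..n}"
        using that(1) T by (intro single_in_pp_in) auto
    qed
  next
    show "determined_by n T E"
      unfolding determined_by_def
    proof (intro ballI impI)
      fix a b
      assume a: "a \<in> E" and b: "b \<in> pp_in {1..n}" and ab: "\<forall>i\<in>T. lookup a i = lookup b i"
      have a_pp: "a \<in> pp_in {1..n}" using a E(1) by (auto simp: up_closed_def)
      define a1 where "a1 = pp_of n (\<lambda>i. if i \<in> T then lookup a i else 0)"
      define a2 where "a2 = pp_of n (\<lambda>i. if i \<in> T then 0 else lookup a i)"
      have "a = a1 + a2"
        using a_pp by (intro poly_mapping_eqI) (simp add: a1_def a2_def lookup_add lookup_pp_of in_pp_in_iff)
      then have "mon a1 * mon a2 \<in> Q"
        using a by (simp add: E(2) mon_in_spanned_iff flip: mon_mult)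
      moreover have "mon a1 \<in> carrier (poly_ring n :: 'k mpoly ring)"
        "mon a2 \<in> carrier (poly_ring n :: 'k mpoly ring)"
        unfolding carrier_poly_ring mon_in_spanned_iff a1_def a2_def by (rule pp_of_in_pp_in)+
      moreover have "mon a2 \<notin> radical n Q"
        unfolding rad mon_in_spanned_iff by (auto simp: a2_def lookup_pp_of)
      ultimately have "mon a1 \<in> Q" using assms(2) unfolding primary_ideal_def by blast
      then have "a1 \<in> E" by (simp add: E(2) mon_in_spanned_iff)
      then show "b \<in> E"
        by (rule up_closedD[OF E(1) _ b]) (simp add: a1_def lookup_pp_of ab)
    qed
  qed
qed

text \<open>If some exponent in \<open>T\<close> reaches \<open>N\<close>, then \<open>a\<close> and
  its truncation both lie above a pure power in \<open>E\<close>; otherwise truncation changes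
  nothing on \<open>T\<close>.\<close>

lemma primary_truncation:
  assumes E: "up_closed n E" and N: "\<And>i. i \<in> T \<Longrightarrow> Poly_Mapping.single i N \<in> E" and T: "T \<subseteq> {1..n}"
    and dep: "determined_by n T E"
    and a: "a \<in> pp_in {1..n}"
  shows "a \<in> E \<longleftrightarrow> pp_of n (\<lambda>i. min (lookup a i) N) \<in> E" (is "_ \<longleftrightarrow> ?b \<in> E")
proof (cases "\<exists>i\<in>T. N \<le> lookup a i")
  case True
  then obtain i where i: "i \<in> T" "N \<le> lookup a i" by blast
  have "a \<in> E"
    using i a by (intro up_closedD[OF E N[OF i(1)]]) (auto simp: lookup_single when_def)
  moreover have "?b \<in> E"
    using i T pp_of_in_pp_in
    by (intro up_closedD[OF E N[OF i(1)]]) (auto simp: lookup_single when_def lookup_pp_of subset_iff)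
  ultimately show ?thesis by simp
next
  case False
  have eq: "lookup ?b i = lookup a i" if "i \<in> T" for i
  proof -
    have "i \<in> {1..n}" "lookup a i < N" using that T False by auto
    then show ?thesis by (simp add: lookup_pp_of)
  qed
  show ?thesis using determined_byD[OF dep, of a ?b] determined_byD[OF dep, of ?b a] eq a pp_of_in_pp_in
    by metis
qed

text \<open>Irreducible means generated by pure powers. A generator that is not a pure power splits
  into coprime factors, and adjoining each factor separately writes the ideal as an intersection of
  two larger ones.\<close>

lemma irreducible_exponents:
  fixes E :: "(nat \<Rightarrow>\<^sub>0 nat) set"
  assumes irr: "irreducible_monomial_ideal n (spanned E :: 'k::field mpoly set)"
    and E: "up_closed n E" "0 \<notin> E"
    and T: "\<And>i. i \<in> T \<Longrightarrow> Poly_Mapping.single i N \<in> E" "T \<subseteq> {1..n}"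
    and dep: "determined_by n T E"
  obtains \<alpha> where "\<And>i. 0 < \<alpha> i" "\<And>a. a \<in> pp_in {1..n} \<Longrightarrow> a \<in> E \<longleftrightarrow> (\<exists>i\<in>T. \<alpha> i \<le> lookup a i)"
proof -
  \<comment> \<open>The least pure power in the ideal; the value 1 outside \<open>T\<close> keeps
    the thresholds positive.\<close>
  define \<alpha> where "\<alpha> i = (if i \<in> T then LEAST k. Poly_Mapping.single i k \<in> E else 1)" for i
  have \<alpha>: "Poly_Mapping.single i (\<alpha> i) \<in> E" if "i \<in> T" for i
    using LeastI[of "\<lambda>k. Poly_Mapping.single i k \<in> E", OF T(1)[OF that]] that by (simp add: \<alpha>_def)
  have \<alpha>_le: "i \<in> T \<and> \<alpha> i \<le> k" if "Poly_Mapping.single i k \<in> E" for i k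
  proof -
    have "i \<in> T"
    proof (rule ccontr)
      assume "i \<notin> T"
      then have "0 \<in> E" by (intro determined_byD[OF dep that]) (auto simp: in_pp_in_iff lookup_single when_def)
      then show False using E(2) by simp
    qed
    then show ?thesis using that by (auto simp: \<alpha>_def intro: Least_le)
  qed
  have "0 < \<alpha> i" for i
    using \<alpha>[of i] E(2) by (cases "i \<in> T") (auto simp: \<alpha>_def intro!: gr0I)
  moreover have "\<exists>i\<in>T. \<alpha> i \<le> lookup a i" if "a \<in> E" for a
  proof (rule ccontr)
    let ?P = "\<lambda>a. a \<in> E \<and> (\<forall>i\<in>T. lookup a i < \<alpha> i)" and ?deg = "\<lambda>a. \<Sum>i\<in>{1..n}. lookup a i"
    assume "\<not> (\<exists>i\<in>T. \<alpha> i \<le> lookup a i)"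
    then have "?P a" using that by (auto simp: not_le)
    \<comment> \<open>An exponent of least degree that lies above no pure power in \<open>E\<close>.
      It is split below into a power \<open>b\<close> of one variable and the rest \<open>c\<close>;
      \<open>b\<close> is outside \<open>E\<close> since \<open>a\<close> is below the thresholds,
      \<open>c\<close> since its degree is smaller.\<close>
    then obtain a where a: "?P a" and min: "\<And>b. ?P b \<Longrightarrow> ?deg a \<le> ?deg b"
      using ex_has_least_nat[of ?P a ?deg] by blast
    have a_pp: "a \<in> pp_in {1..n}" using a E(1) by (auto simp: up_closed_def)
    have "a \<noteq> 0" using a E(2) by blast
    then obtain k where k: "lookup a k \<noteq> 0" by (metis lookup_zero poly_mapping_eqI)
    then have kn: "k \<in> {1..n}" using a_pp by (auto simp: in_pp_in_iff)
    define b where "b = Poly_Mapping.single k (lookup a k)"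
    define c where "c = pp_of n (\<lambda>i. if i = k then 0 else lookup a i)"
    have pp: "b \<in> pp_in {1..n}" "c \<in> pp_in {1..n}"
      unfolding b_def c_def using kn by (rule single_in_pp_in) (rule pp_of_in_pp_in)
    have "b \<notin> E" using \<alpha>_le[of k "lookup a k"] a by (metis b_def leD)
    have "c \<notin> E"
    proof
      assume "c \<in> E"
      have le: "lookup c i \<le> lookup a i" for i by (simp add: c_def lookup_pp_of)
      then have "?P c" using \<open>c \<in> E\<close> a le_less_trans by blast
      then have "?deg a \<le> ?deg c" by (rule min)
      moreover have "?deg c < ?deg a"
        using k kn le by (intro sum_strict_mono_ex1) (auto simp: c_def lookup_pp_of intro!: bexI[of _ k])
      ultimately show False by simp
    qed
    let ?J = "\<lambda>b. E \<union> cell b {1..n}"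
    have J: "monomial_ideal n (spanned (?J b) :: 'k mpoly set)" if "b \<in> pp_in {1..n}" for b
    proof -
      have "up_closed n (cell b {1..n})" using up_closed_cells[of "{b}" n] that by simp
      then have "up_closed n (?J b)" using E(1) unfolding up_closed_def by blast
      then show ?thesis unfolding monomial_ideal_iff by blast
    qed
    have sub: "(spanned E :: 'k mpoly set) \<subset> spanned (?J b)" if "b \<notin> E" for b
    proof -
      have "mon b \<in> (spanned (?J b) :: 'k mpoly set)" "mon b \<notin> (spanned E :: 'k mpoly set)"
        using that by (simp_all add: mon_in_spanned_iff base_in_cell)
      moreover have "(spanned E :: 'k mpoly set) \<subseteq> spanned (?J b)" by (auto simp: spanned_def)
      ultimately show ?thesis by blast
    qed
    \<comment> \<open>As \<open>b\<close> and \<open>c\<close> have disjoint supports, an exponent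
      above both is above \<open>a\<close>.\<close>
    have "x \<in> E" if x: "x \<in> cell b {1..n}" "x \<in> cell c {1..n}" for x
    proof (rule up_closedD[OF E(1)])
      show "a \<in> E" using a by blast
      show "x \<in> pp_in {1..n}" using x(1) pp(1) unfolding cell_def by (auto intro: pp_in_add)
      fix i
      have "lookup b i \<le> lookup x i" "lookup c i \<le> lookup x i" using x by (auto simp: in_cell_iff)
      then show "lookup a i \<le> lookup x i"
        using a_pp by (cases "i = k") (auto simp: b_def c_def lookup_pp_of in_pp_in_iff split: if_splits)
    qed
    then have "?J b \<inter> ?J c = E" by blast
    then have "(spanned E :: 'k mpoly set) = spanned (?J b) \<inter> spanned (?J c)"
      by (auto simp: spanned_def)
    then show False
      using irr J[OF pp(1)] J[OF pp(2)] sub[OF \<open>b \<notin> E\<close>] sub[OF \<open>c \<notin> E\<close>]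
      unfolding irreducible_monomial_ideal_def by blast
  qed
  moreover have "a \<in> E" if "a \<in> pp_in {1..n}" "i \<in> T" "\<alpha> i \<le> lookup a i" for a i
    using that by (intro up_closedD[OF E(1) \<alpha>[OF that(2)]]) (auto simp: lookup_single when_def)
  ultimately show thesis using that[of \<alpha>] by blast
qed

section \<open>The bounds\<close>

lemma pp_of_single: "i \<in> {1..n} \<Longrightarrow> pp_of n (\<lambda>j. of_bool (j \<in> {i})) = Poly_Mapping.single i 1"
  by (intro poly_mapping_eqI) (auto simp: lookup_pp_of lookup_single when_def)

lemma pp_of_empty: "pp_of n (\<lambda>j. of_bool (j \<in> {})) = 0"
  by (intro poly_mapping_eqI) (auto simp: lookup_pp_of)

lemma pp_of_pair:
  "i \<in> {1..n} \<Longrightarrow> j \<in> {1..n} \<Longrightarrow> i \<noteq> j \<Longrightarrow>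
    pp_of n (\<lambda>k. of_bool (k \<in> {i, j})) = Poly_Mapping.single i 1 + Poly_Mapping.single j 1"
  by (intro poly_mapping_eqI) (auto simp: lookup_pp_of lookup_add lookup_single when_def)

text \<open>The counting bound for singletons, where exchange replaces the only element.\<close>

lemma sdepth_bound_singles:
  assumes "up_closed n E" "celled n 0 E" "T \<subseteq> {1..n}" "T \<noteq> {}" "v \<in> pp_in {1..n}" "v \<notin> E"
    and "\<And>i. i \<in> T \<Longrightarrow> v + Poly_Mapping.single i 1 \<in> E"
  shows "2 * sdepth n (spanned E :: 'k::field mpoly set) + card T \<le> 2 * n + 1"
proof (rule sdepth_counting_bound[OF assms(1-3,5), of "(\<lambda>i. {i}) ` T"])
  fix G assume "G \<in> (\<lambda>i. {i}) ` T"
  then obtain i where i: "G = {i}" "i \<in> T" by blast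
  then show "G \<subseteq> T \<and> card G = 1 \<and> v + pp_of n (\<lambda>i. of_bool (i \<in> G)) \<in> E"
    using assms(3,7) pp_of_single[of i n] by auto
  show "v + pp_of n (\<lambda>i. of_bool (i \<in> G - {x})) \<notin> E" if "x \<in> G" for x
  proof -
    have "G - {x} = {}" using i that by auto
    then show ?thesis using assms(6) by (simp only: pp_of_empty) simp
  qed
  show "\<exists>x\<in>G. insert k (G - {x}) \<in> (\<lambda>i. {i}) ` T" if "k \<in> T - G" for k
    using that i by auto
qed (use assms(4) in auto)

text \<open>The counting bound for the edges of the complete bipartite graph on \<open>R\<close> and
  \<open>S\<close>; exchange replaces the endpoint on the side of the new element.\<close>

lemma sdepth_bound_pairs:
  assumes "up_closed n E" "celled n 0 E" "R \<subseteq> {1..n}" "S \<subseteq> {1..n}" "R \<noteq> {}" "S \<noteq> {}" "R \<inter> S = {}"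
    and v: "v \<in> pp_in {1..n}" "\<And>i. i \<in> R \<union> S \<Longrightarrow> v + Poly_Mapping.single i 1 \<notin> E"
    and ij: "\<And>i j. i \<in> R \<Longrightarrow> j \<in> S \<Longrightarrow> v + (Poly_Mapping.single i 1 + Poly_Mapping.single j 1) \<in> E"
  shows "2 * sdepth n (spanned E :: 'k::field mpoly set) + (card R + card S) \<le> 2 * n + 2"
proof -
  have "finite R" "finite S" using assms(3,4) finite_subset by blast+
  then have card: "card (R \<union> S) = card R + card S" using assms(7) by (rule card_Un_disjoint)
  let ?G = "{{i, j} | i j. i \<in> R \<and> j \<in> S}"
  have "2 * sdepth n (spanned E :: 'k mpoly set) + card (R \<union> S) \<le> 2 * n + 2"
  proof (rule sdepth_counting_bound[OF assms(1,2) _ v(1), of "R \<union> S" ?G])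
    show "R \<union> S \<subseteq> {1..n}" "?G \<noteq> {}" using assms by auto
    fix G assume "G \<in> ?G"
    then obtain i j where G: "G = {i, j}" "i \<in> R" "j \<in> S" by blast
    then have n: "i \<in> {1..n}" "j \<in> {1..n}" "i \<noteq> j" using assms by auto
    show "G \<subseteq> R \<union> S \<and> card G = 2 \<and> v + pp_of n (\<lambda>i. of_bool (i \<in> G)) \<in> E"
      unfolding G(1) pp_of_pair[OF n] using G ij n by simp
    show "v + pp_of n (\<lambda>i. of_bool (i \<in> G - {x})) \<notin> E" if "x \<in> G" for x
    proof -
      have "G - {x} = {i} \<or> G - {x} = {j}" using G that n(3) by auto
      then show ?thesis
      proof
        assume "G - {x} = {i}"
        then show ?thesis using v(2) G(2) by (simp only: pp_of_single[OF n(1)]) blast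
      next
        assume "G - {x} = {j}"
        then show ?thesis using v(2) G(3) by (simp only: pp_of_single[OF n(2)]) blast
      qed
    qed
    show "\<exists>x\<in>G. insert k (G - {x}) \<in> ?G" if "k \<in> R \<union> S - G" for k
    proof (cases "k \<in> R")
      case True
      then have "insert k (G - {i}) = {k, j}" using G n(3) by auto
      then show ?thesis using True G by blast
    next
      case False
      then have "insert k (G - {j}) = {i, k}" "k \<in> S" using G n(3) that by auto
      then show ?thesis using G by blast
    qed
  qed
  then show ?thesis unfolding card .
qed

text \<open>The sets meeting both \<open>{1..r}\<close> and \<open>{r+1..p}\<close> are tiled with
  tops of size \<open>p div 2 + 1\<close>. The variables beyond \<open>p\<close> are free, adding
  \<open>n - p\<close> to every top.\<close>

lemma sdepth_mixed_ge:
  assumes "1 \<le> r" "r < p" "p \<le> n" and \<alpha>: "\<And>i. 0 < \<alpha> i" "\<And>i. 0 < \<beta> i"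
  defines "E \<equiv> {a \<in> pp_in {1..n}. (\<exists>i\<in>{1..r}. \<alpha> i \<le> lookup a i) \<and> (\<exists>i\<in>{r+1..p}. \<beta> i \<le> lookup a i)}"
  shows "n - p + p div 2 + 1 \<le> sdepth n (spanned E :: 'k::field mpoly set)"
proof (rule sdepth_ge)
  let ?R = "{1..r}" and ?S = "{r+1..p}" and ?F = "{p+1..n}"
  \<comment> \<open>The two index ranges are disjoint, so both families of thresholds fit into one
    function.\<close>
  define \<gamma> where "\<gamma> i = (if i \<le> r then \<alpha> i else \<beta> i)" for i
  let ?U = "((Pow ?R - {{}}) \<bowtie> (Pow ?S - {{}})) \<bowtie> Pow ?F"
  let ?\<phi> = "\<lambda>a. {i \<in> {1..n}. \<gamma> i \<le> lookup a i}"
  have U: "X \<in> ?U \<longleftrightarrow> X \<inter> ?R \<noteq> {} \<and> X \<inter> ?S \<noteq> {}" if X: "X \<subseteq> {1..n}" for X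
  proof
    assume r: "X \<inter> ?R \<noteq> {} \<and> X \<inter> ?S \<noteq> {}"
    have "{1..n} = ?R \<union> ?S \<union> ?F" using assms(1-3) by auto
    then have "X = (X \<inter> ?R \<union> X \<inter> ?S) \<union> X \<inter> ?F" using X by blast
    moreover have "X \<inter> ?R \<union> X \<inter> ?S \<in> (Pow ?R - {{}}) \<bowtie> (Pow ?S - {{}})"
      using r unfolding joins_def by blast
    moreover have "X \<inter> ?F \<in> Pow ?F" by blast
    ultimately show "X \<in> ?U" unfolding joins_def[of _ "Pow ?F"] by blast
  qed (auto simp: joins_def)
  have "tiled ((card ?R + card ?S) div 2 + 1) ((Pow ?R - {{}}) \<bowtie> (Pow ?S - {{}}))"
    using assms(1-3) by (intro tiled_mixed) auto
  moreover have "tiled (n - p) (Pow ?F)"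
  proof -
    have "Pow ?F = {{}..?F}" by (intro equalityI subsetI) simp_all
    then show ?thesis by (simp only:) (rule tiled_single, auto)
  qed
  ultimately have "tiled ((card ?R + card ?S) div 2 + 1 + (n - p)) ?U"
    by (rule tiled_joins[where R = "{1..p}" and S = ?F]) (use assms(1-3) in \<open>auto simp: joins_def\<close>)
  moreover have "(card ?R + card ?S) div 2 + 1 + (n - p) = n - p + p div 2 + 1"
    using assms(1-3) by simp
  moreover have "?U \<subseteq> Pow {1..n}" using assms(1-3) by (auto simp: joins_def)
  ultimately have "celled n (n - p + p div 2 + 1) {a \<in> pp_in {1..n}. ?\<phi> a \<in> ?U}"
    using \<alpha> by (intro celled_thresholds) (simp_all add: \<gamma>_def add.commute)
  moreover have "E = {a \<in> pp_in {1..n}. ?\<phi> a \<in> ?U}"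
  proof -
    have "?\<phi> a \<inter> ?R = {i \<in> ?R. \<alpha> i \<le> lookup a i}" "?\<phi> a \<inter> ?S = {i \<in> ?S. \<beta> i \<le> lookup a i}" for a
      using assms(1-3) by (auto simp: \<gamma>_def)
    then have "?\<phi> a \<inter> ?R \<noteq> {} \<longleftrightarrow> (\<exists>i\<in>?R. \<alpha> i \<le> lookup a i)"
      "?\<phi> a \<inter> ?S \<noteq> {} \<longleftrightarrow> (\<exists>i\<in>?S. \<beta> i \<le> lookup a i)" for a by blast+
    moreover have "?\<phi> a \<subseteq> {1..n}" for a by blast
    ultimately show ?thesis unfolding E_def using U by presburger
  qed
  ultimately show "celled n (n - p + p div 2 + 1) E" by simp
  have "pp_of n (\<lambda>i. \<alpha> i + \<beta> i) \<in> E"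
    unfolding E_def using assms(1-3) pp_of_in_pp_in
    by (auto simp: lookup_pp_of intro!: bexI[of _ 1] bexI[of _ p])
  then show "E \<noteq> {}" by blast
qed

text \<open>The first of the three terms may be half an odd integer, so the equality of depth and
  bound is expressed through the integer part of the bound.\<close>

theorem theorem2p19:
  fixes Q Q' :: "'k::field mpoly set" and n r t p :: nat
  assumes "1 < r" and "r \<le> t" and "t < p" and "p \<le> n" and "4 \<le> n"
    and "monomial_ideal n Q" and "primary_ideal n Q"
    and "monomial_ideal n Q'" and "primary_ideal n Q'"
    and "radical n Q = Idl\<^bsub>poly_ring n\<^esub> (var ` {1..t})"
    and "radical n Q' = Idl\<^bsub>poly_ring n\<^esub> (var ` {r+1..p})"
  defines "bound \<equiv> Min {(2 * real n + real t - real p - real r + 2) / 2,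
                        real n - \<lfloor>real t / 2\<rfloor>,
                        real n - \<lfloor>(real p - real t) / 2\<rfloor>}"
  shows "real (sdepth n (Q \<inter> Q')) \<le> bound \<and>
         (t = r \<and> odd n \<and> irreducible_monomial_ideal n Q \<and> irreducible_monomial_ideal n Q'
            \<longrightarrow> int (sdepth n (Q \<inter> Q')) = \<lfloor>bound\<rfloor>)"
proof -
  let ?T = "{1..t}" and ?T' = "{r+1..p}"
  have T: "?T \<subseteq> {1..n}" "?T' \<subseteq> {1..n}" using assms(1-4) by auto
  obtain E N where E: "up_closed n E" "Q = spanned E" "0 \<notin> E"
    "\<And>i M. i \<in> ?T \<Longrightarrow> N \<le> M \<Longrightarrow> Poly_Mapping.single i M \<in> E"
    "determined_by n ?T E"
    using primary_exponents[OF assms(6,7,10) T(1)] by blast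
  obtain E' N' where E': "up_closed n E'" "Q' = spanned E'" "0 \<notin> E'"
    "\<And>i M. i \<in> ?T' \<Longrightarrow> N' \<le> M \<Longrightarrow> Poly_Mapping.single i M \<in> E'"
    "determined_by n ?T' E'"
    using primary_exponents[OF assms(8,9,11) T(2)] by blast
  define F where "F = E \<inter> E'"
  define s where "s = sdepth n (spanned F :: 'k mpoly set)"
  have QF: "Q \<inter> Q' = spanned F" unfolding E(2) E'(2) F_def by (auto simp: spanned_def)
  have F: "up_closed n F" unfolding F_def using E(1) E'(1) by (rule up_closed_Int)
  have celled: "celled n 0 F"
  proof (rule celled_truncation)
    show "F \<subseteq> pp_in {1..n}" using F by (simp add: up_closed_def)
    \<comment> \<open>One cap must work for both ideals, so the larger of the two exponents is
      used.\<close>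
    let ?M = "max N N'"
    fix a :: "nat \<Rightarrow>\<^sub>0 nat" assume a: "a \<in> pp_in {1..n}"
    have "a \<in> E \<longleftrightarrow> pp_of n (\<lambda>i. min (lookup a i) ?M) \<in> E"
      by (rule primary_truncation[OF E(1) _ T(1) E(5) a]) (rule E(4), simp_all)
    moreover have "a \<in> E' \<longleftrightarrow> pp_of n (\<lambda>i. min (lookup a i) ?M) \<in> E'"
      by (rule primary_truncation[OF E'(1) _ T(2) E'(5) a]) (rule E'(4), simp_all)
    ultimately show "a \<in> F \<longleftrightarrow> pp_of n (\<lambda>i. min (lookup a i) ?M) \<in> F" by (simp add: F_def)
  qed
  let ?e = "\<lambda>i. Poly_Mapping.single i (1::nat)"
  have e: "?e i \<in> pp_in {1..n}" if "i \<in> {1..n}" for i using that by (rule single_in_pp_in)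
  have bound_t: "2 * s + t \<le> 2 * n + 1"
  proof -
    obtain u where u: "u \<in> pp_in ?T" "u \<notin> E" "\<And>i. i \<in> ?T \<Longrightarrow> u + ?e i \<in> E"
      using maximal_outside[OF E(1,3) T(1) E(4)[OF _ order_refl]] by metis
    have u_pp: "u \<in> pp_in {1..n}" using u(1) T(1) by (rule pp_in_mono)
    \<comment> \<open>A high power of the variable \<open>p\<close> puts everything into
      \<open>E'\<close>, while \<open>p > t\<close> makes it invisible to \<open>E\<close>. Then
      only membership in \<open>E\<close> matters.\<close>
    let ?w = "Poly_Mapping.single p N'"
    have w: "?w \<in> pp_in {1..n}" "?w \<in> E'" using assms(1-4) E'(4)[of p N'] by (auto intro: single_in_pp_in)
    have "2 * sdepth n (spanned F :: 'k mpoly set) + card ?T \<le> 2 * n + 1"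
    proof (rule sdepth_bound_singles[OF F celled T(1)])
      show v: "u + ?w \<in> pp_in {1..n}" using u_pp w(1) by (rule pp_in_add)
      show "u + ?w \<notin> F"
      proof
        assume "u + ?w \<in> F"
        then have "u \<in> E" using assms(3)
          by (intro determined_byD[OF E(5), of "u + ?w" u] u_pp) (auto simp: F_def lookup_add lookup_single when_def)
        then show False using u(2) by simp
      qed
      fix i assume i: "i \<in> ?T"
      then have vi: "u + ?w + ?e i \<in> pp_in {1..n}" by (intro pp_in_add[OF v] e subsetD[OF T(1)])
      have "u + ?w + ?e i \<in> E" by (rule up_closedD[OF E(1) u(3)[OF i] vi]) (simp add: lookup_add)
      moreover have "u + ?w + ?e i \<in> E'" by (rule up_closedD[OF E'(1) w(2) vi]) (simp add: lookup_add)
      ultimately show "u + ?w + ?e i \<in> F" by (simp add: F_def)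
    qed (use assms(1-3) in auto)
    then show ?thesis by (simp add: s_def)
  qed
  let ?S = "{t+1..p}"
  have S: "?S \<subseteq> ?T'" "?S \<subseteq> {1..n}" "?S \<noteq> {}" using assms(1-4) by auto
  \<comment> \<open>The support avoids \<open>{1..t}\<close>, so that adding \<open>u'\<close> does
    not affect membership in \<open>E\<close>.\<close>
  obtain u' where u': "u' \<in> pp_in ?S" "u' \<notin> E'" "\<And>i. i \<in> ?S \<Longrightarrow> u' + ?e i \<in> E'"
    using maximal_outside[OF E'(1,3) S(2) E'(4)[OF _ order_refl]] S(1) by (metis subsetD)
  have u'_pp: "u' \<in> pp_in {1..n}" using u'(1) S(2) by (rule pp_in_mono)
  have bound_pt: "2 * s + (p - t) \<le> 2 * n + 1"
  proof -
    let ?w = "Poly_Mapping.single 1 N"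
    have w: "?w \<in> pp_in {1..n}" "?w \<in> E" using assms(1-4) E(4)[of 1 N] by (auto intro: single_in_pp_in)
    have "2 * sdepth n (spanned F :: 'k mpoly set) + card ?S \<le> 2 * n + 1"
    proof (rule sdepth_bound_singles[OF F celled S(2,3)])
      show v: "u' + ?w \<in> pp_in {1..n}" using u'_pp w(1) by (rule pp_in_add)
      show "u' + ?w \<notin> F"
      proof
        assume "u' + ?w \<in> F"
        then have "u' \<in> E'" using assms(1)
          by (intro determined_byD[OF E'(5), of "u' + ?w" u'] u'_pp) (auto simp: F_def lookup_add lookup_single when_def)
        then show False using u'(2) by simp
      qed
      fix i assume i: "i \<in> ?S"
      then have vi: "u' + ?w + ?e i \<in> pp_in {1..n}" by (intro pp_in_add[OF v] e subsetD[OF S(2)])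
      have "u' + ?w + ?e i \<in> E'" by (rule up_closedD[OF E'(1) u'(3)[OF i] vi]) (simp add: lookup_add)
      moreover have "u' + ?w + ?e i \<in> E" by (rule up_closedD[OF E(1) w(2) vi]) (simp add: lookup_add)
      ultimately show "u' + ?w + ?e i \<in> F" by (simp add: F_def)
    qed
    then show ?thesis by (simp add: s_def)
  qed
  have bound_pairs: "2 * s + (r + (p - t)) \<le> 2 * n + 2"
  proof -
    let ?R = "{1..r}"
    have R: "?R \<subseteq> ?T" "?R \<subseteq> {1..n}" using assms(1-4) by auto
    obtain u where u: "u \<in> pp_in ?R" "u \<notin> E" "\<And>i. i \<in> ?R \<Longrightarrow> u + ?e i \<in> E"
      using maximal_outside[OF E(1,3) R(2) E(4)[OF _ order_refl]] R(1) by (metis subsetD)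
    have u_pp: "u \<in> pp_in {1..n}" using u(1) R(2) by (rule pp_in_mono)
    have v: "u + u' \<in> pp_in {1..n}" using u_pp u'_pp by (rule pp_in_add)
    \<comment> \<open>In \<open>u + u'\<close> the set \<open>E\<close> sees only \<open>u\<close>,
      and \<open>E'\<close> sees only \<open>u'\<close>. One further step enters at most one of the
      two sets, while a step from each side enters both.\<close>
    have out: "lookup u i = 0" if "i \<in> ?T'" for i using u(1) that by (simp add: in_pp_in_iff)
    have out': "lookup u' i = 0" if "i \<in> ?T" for i using u'(1) that by (simp add: in_pp_in_iff)
    have "2 * sdepth n (spanned F :: 'k mpoly set) + (card ?R + card ?S) \<le> 2 * n + 2"
    proof (rule sdepth_bound_pairs[OF F celled R(2) S(2) _ S(3) _ v])
      show "?R \<noteq> {}" "?R \<inter> ?S = {}" using assms(1-3) by auto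
      show "u + u' + ?e i \<notin> F" if "i \<in> ?R \<union> ?S" for i
      proof (cases "i \<in> ?R")
        case True
        have "u + u' + ?e i \<notin> E'"
        proof
          assume "u + u' + ?e i \<in> E'"
          then have "u' \<in> E'" using True out
            by (intro determined_byD[OF E'(5), of "u + u' + ?e i" u'] u'_pp) (auto simp: lookup_add lookup_single when_def)
          then show False using u'(2) by simp
        qed
        then show ?thesis by (simp add: F_def)
      next
        case False
        have "u + u' + ?e i \<notin> E"
        proof
          assume "u + u' + ?e i \<in> E"
          then have "u \<in> E" using False that out'
            by (intro determined_byD[OF E(5), of "u + u' + ?e i" u] u_pp) (auto simp: lookup_add lookup_single when_def)
          then show False using u(2) by simp
        qed
        then show ?thesis by (simp add: F_def)
      qed
      show "u + u' + (?e i + ?e j) \<in> F" if i: "i \<in> ?R" and j: "j \<in> ?S" for i j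
      proof -
        have vij: "u + u' + (?e i + ?e j) \<in> pp_in {1..n}"
          by (intro pp_in_add[OF v] pp_in_add e subsetD[OF R(2) i] subsetD[OF S(2) j])
        have "u + u' + (?e i + ?e j) \<in> E"
          by (rule up_closedD[OF E(1) u(3)[OF i] vij]) (simp add: lookup_add)
        moreover have "u + u' + (?e i + ?e j) \<in> E'"
          by (rule up_closedD[OF E'(1) u'(3)[OF j] vij]) (simp add: lookup_add)
        ultimately show ?thesis by (simp add: F_def)
      qed
    qed
    then show ?thesis by (simp add: s_def)
  qed
  have floor: "\<lfloor>real t / 2\<rfloor> = int (t div 2)" "\<lfloor>(real p - real t) / 2\<rfloor> = int ((p - t) div 2)"
    using floor_divide_of_nat_eq[of t 2] floor_divide_of_nat_eq[of "p - t" 2] assms(3)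
    by (simp_all add: of_nat_diff)
  have upper: "real s \<le> bound"
  proof -
    have "real s \<le> (2 * real n + real t - real p - real r + 2) / 2"
    proof -
      have "2 * s + r + p \<le> 2 * n + 2 + t" using bound_pairs assms(3) by linarith
      then have "real (2 * s + r + p) \<le> real (2 * n + 2 + t)" by (simp only: of_nat_le_iff)
      then show ?thesis by simp
    qed
    moreover have "s + t div 2 \<le> n" "s + (p - t) div 2 \<le> n" using bound_t bound_pt by linarith+
    ultimately show ?thesis unfolding bound_def floor by auto
  qed
  moreover have "int s = \<lfloor>bound\<rfloor>"
    if tr: "t = r" and irr: "irreducible_monomial_ideal n Q" "irreducible_monomial_ideal n Q'"
  proof -
    obtain \<alpha> where \<alpha>: "\<And>i. 0 < \<alpha> i" "\<And>a. a \<in> pp_in {1..n} \<Longrightarrow> a \<in> E \<longleftrightarrow> (\<exists>i\<in>?T. \<alpha> i \<le> lookup a i)"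
      using irreducible_exponents[OF irr(1)[unfolded E(2)] E(1,3) E(4)[OF _ order_refl] T(1) E(5)] by blast
    obtain \<beta> where \<beta>: "\<And>i. 0 < \<beta> i" "\<And>a. a \<in> pp_in {1..n} \<Longrightarrow> a \<in> E' \<longleftrightarrow> (\<exists>i\<in>?T'. \<beta> i \<le> lookup a i)"
      using irreducible_exponents[OF irr(2)[unfolded E'(2)] E'(1,3) E'(4)[OF _ order_refl] T(2) E'(5)] by blast
    have "F = {a \<in> pp_in {1..n}. (\<exists>i\<in>{1..r}. \<alpha> i \<le> lookup a i) \<and> (\<exists>i\<in>{r+1..p}. \<beta> i \<le> lookup a i)}"
      using \<alpha>(2) \<beta>(2) E(1) E'(1) tr unfolding F_def up_closed_def by blast
    then have "n - p + p div 2 + 1 \<le> s"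
      unfolding s_def using sdepth_mixed_ge[of r p n \<alpha> \<beta>, where 'k = 'k] assms(1-4) \<alpha>(1) \<beta>(1) by simp
    \<comment> \<open>For \<open>t = r\<close> the first term is \<open>n - p / 2 + 1\<close>, less
      than one above the lower bound. As the depth is an integer between the lower bound and
      \<open>bound\<close>, it equals the integer part.\<close>
    moreover have "bound < real (n - p + p div 2 + 1) + 1"
    proof -
      have "bound \<le> (2 * real n + real t - real p - real r + 2) / 2"
        unfolding bound_def by (rule Min_le) simp_all
      moreover have "2 * n + 2 < p + 2 * (n - p + p div 2 + 1) + 2" using assms(4) by presburger
      then have "real (2 * n + 2) < real (p + 2 * (n - p + p div 2 + 1) + 2)"
        by (simp only: of_nat_less_iff)
      ultimately show ?thesis using tr by simp
    qed
    ultimately show ?thesis using upper by linarith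
  qed
  ultimately show ?thesis unfolding QF s_def[symmetric] by blast
qed

end
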